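(* Suppose that the noises $\{\xi_t\}$ are i.i.d. with mean $0$ and variance $1$, and that the sampling distribution $\mathsf Z$ satisfies conditions (B1) and (B2) of the context. Fix $\varepsilon\in(0,1/2)$. Then there exists some $c_0=c_0(K,\Delta,\varepsilon,\sigma,\mathscr L(\mathsf Z))>1$ such that $$\inf_{T\ge c_0}\mathbb P\bigg(1-\varepsilon\le \frac{n_{a;T}/\sigma^2}{[\bar\Phi^-(1/T)/\Delta_a]^2}\le 1+\varepsilon+\frac{c_0}{[\bar\Phi^-(1/T)]^2},\ \forall a\in\mathcal A_+\bigg)\ge 1-\varepsilon .$$
   Context: Notation: $[K]=\{1,\dots,K\}$; $\mathscr L(X)$ is the law of $X$. Bandit model. There are $K$ arms with mean rewards $\mu_1,\dots,\mu_K\in\mathbb R$ and noise level $\sigma>0$. At round $t$ an arm $A_t\in[K]$ is selected and the reward $R_t=\mu_{A_t}+\sigma\xi_t$ is observed, where $\{\xi_t\}$ are i.i.d. standardized noise variables. Let $\mu_*=\max_b\mu_b$, $\Delta_a=\mu_*-\mu_a\ge0$, $\Delta=(\Delta_a)_{a\in[K]}$, $\mathcal A_0=\{a:\Delta_a=0\}$ (optimal arms), $\mathcal A_+=\{a:\Delta_a>0\}$ (suboptimal arms). Algorithm (generalized Gaussian Thompson sampling with sampling distribution $\mathsf Z$). Set $\bar n_{a;0}=1$, $\bar\mu_{a;0}=0$ for all $a$. For $t=1,2,\dots$: pull $A_t\in\arg\max_{a\in[K]}\{\bar\mu_{a;t-1}+\sigma\,\bar n_{a;t-1}^{-1/2}Z_{a;t}\}$,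 where $Z_{\cdot;\cdot}$ are i.i.d. copies of $\mathsf Z$ (independent of the noises), observe $R_t$, and update $\bar n_{a;t}=\bar n_{a;t-1}+\mathbf 1_{A_t=a}$, $\bar\mu_{a;t}=\bar n_{a;t}^{-1}(\bar n_{a;t-1}\bar\mu_{a;t-1}+\mathbf 1_{A_t=a}R_t)$ for all $a$. The arm-pull count is $n_{a;T}=\sum_{s=1}^T\mathbf 1_{A_s=a}$. Conditions on $\mathsf Z$. Let $\Phi(z)=\mathbb P(\mathsf Z\le z)$, $\bar\Phi=1-\Phi$. (B1) $\Phi(z)\in(0,1)$ for all $z\in\mathbb R$, $\Phi\in C^1(\mathbb R)$, and $\|\Phi'\|_\infty<\infty$. (B2) For any $c>1$, $\lim_{z\uparrow\infty}\frac{\log z}{-\log\Phi(-z)}=0$ and $\lim_{z\uparrow\infty}\max\{\frac{\log z}{-\log\bar\Phi(z)},\frac{z^2\bar\Phi(cz)}{\bar\Phi(z)}\}=0$. For a non-increasing $F$, $F^-(u)=\inf\{x\in\mathbb R:F(x)\le u\}$ is the generalized inverse.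
   Formalization: The constant c_0 may depend on the mean vector μ, not only on the gaps Δ: with Δ alone the claim fails (shift all means to infinity with T fixed, since estimates start at 0). Also c_0 is uniform over models on one sample-space type; all others follow by transfer to sequence space. *)

theory Defs
  imports "HOL-Probability.Probability"
begin

text \<open>Arms are the natural numbers \<open>1, \<dots>, K\<close>; values of the mean vector outside this range
  play no role.\<close>

definition gap :: "nat \<Rightarrow> (nat \<Rightarrow> real) \<Rightarrow> nat \<Rightarrow> real" where
  "gap K \<mu> a = Max (\<mu> ` {1..K}) - \<mu> a"

definition suboptimal_arms :: "nat \<Rightarrow> (nat \<Rightarrow> real) \<Rightarrow> nat set" where
  "suboptimal_arms K \<mu> = {a \<in> {1..K}. gap K \<mu> a > 0}"

definition tail :: "real measure \<Rightarrow> real \<Rightarrow> real" where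
  "tail \<nu> z = 1 - cdf \<nu> z"

definition gen_inverse :: "(real \<Rightarrow> real) \<Rightarrow> real \<Rightarrow> real" where
  "gen_inverse F u = Inf {x. F x \<le> u}"

definition cond_B1 :: "real measure \<Rightarrow> bool" where
  "cond_B1 \<nu> \<longleftrightarrow>
     (\<forall>z. cdf \<nu> z \<in> {0<..<1}) \<and>
     (\<forall>z. (cdf \<nu> has_real_derivative deriv (cdf \<nu>) z) (at z)) \<and>
     continuous_on UNIV (deriv (cdf \<nu>)) \<and>
     bounded (range (deriv (cdf \<nu>)))"

definition cond_B2 :: "real measure \<Rightarrow> bool" where
  "cond_B2 \<nu> \<longleftrightarrow> (\<forall>c>1.
     ((\<lambda>z. ln z / (- ln (cdf \<nu> (- z)))) \<longlongrightarrow> 0) at_top \<and>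
     ((\<lambda>z. max (ln z / (- ln (tail \<nu> z))) (z\<^sup>2 * tail \<nu> (c * z) / tail \<nu> z)) \<longlongrightarrow> 0) at_top)"

text \<open>The recursions below act on a single trajectory: \<open>A t\<close> is the arm pulled and \<open>R t\<close> the
  reward observed in round \<open>t \<ge> 1\<close>. Since \<open>nbar\<close> starts at 1, it equals \<open>pulls + 1\<close>.\<close>

primrec nbar :: "(nat \<Rightarrow> nat) \<Rightarrow> nat \<Rightarrow> nat \<Rightarrow> real" where
  "nbar A a 0 = 1"
| "nbar A a (Suc t) = nbar A a t + of_bool (A (Suc t) = a)"

primrec mubar :: "(nat \<Rightarrow> nat) \<Rightarrow> (nat \<Rightarrow> real) \<Rightarrow> nat \<Rightarrow> nat \<Rightarrow> real" where
  "mubar A R a 0 = 0"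
| "mubar A R a (Suc t) =
     (nbar A a t * mubar A R a t + of_bool (A (Suc t) = a) * R (Suc t)) / nbar A a (Suc t)"

definition pulls :: "(nat \<Rightarrow> nat) \<Rightarrow> nat \<Rightarrow> nat \<Rightarrow> real" where
  "pulls A a T = (\<Sum>s=1..T. of_bool (A s = a))"

text \<open>A run of the algorithm on a probability space \<open>M\<close>. Time indices of \<open>\<xi>\<close>, \<open>Z\<close> and \<open>A\<close> start
  at 1. Mutual independence of the family indexed by the disjoint sum says that the \<open>\<xi> t\<close> are
  independent, the \<open>Z a t\<close> are independent, and the two families are independent of each other.
  Ties in the maximization may be broken in any measurable way.\<close>

locale thompson_sampling = prob_space M for M :: "'w measure" +
  fixes K :: nat and \<mu> :: "nat \<Rightarrow> real" and \<sigma> :: real and \<nu> :: "real measure"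
    and \<xi> :: "nat \<Rightarrow> 'w \<Rightarrow> real" and Z :: "nat \<Rightarrow> nat \<Rightarrow> 'w \<Rightarrow> real" and A :: "nat \<Rightarrow> 'w \<Rightarrow> nat"
  assumes indep: "indep_vars (\<lambda>_. borel)
      (\<lambda>i. case i of Inl t \<Rightarrow> \<xi> t | Inr (a, t) \<Rightarrow> Z a t)
      ({1..} <+> ({1..K} \<times> {1..}))"
    and noise_identical: "\<And>t. t \<ge> 1 \<Longrightarrow> distr M borel (\<xi> t) = distr M borel (\<xi> 1)"
    and noise_integrable: "integrable M (\<xi> 1)" "integrable M (\<lambda>\<omega>. (\<xi> 1 \<omega>)\<^sup>2)"
    and noise_standardized: "expectation (\<xi> 1) = 0" "variance (\<xi> 1) = 1"
    and sampling_law: "\<And>a t. a \<in> {1..K} \<Longrightarrow> t \<ge> 1 \<Longrightarrow> distr M borel (Z a t) = \<nu>"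
    and arm_measurable: "\<And>t. t \<ge> 1 \<Longrightarrow> A t \<in> measurable M (count_space UNIV)"
    and arm_selection: "\<And>t \<omega>. t \<ge> 1 \<Longrightarrow> \<omega> \<in> space M \<Longrightarrow>
      is_arg_max
        (\<lambda>a. mubar (\<lambda>s. A s \<omega>) (\<lambda>s. \<mu> (A s \<omega>) + \<sigma> * \<xi> s \<omega>) a (t - 1)
             + \<sigma> * nbar (\<lambda>s. A s \<omega>) a (t - 1) powr (- 1 / 2) * Z a t \<omega>)
        (\<lambda>a. a \<in> {1..K}) (A t \<omega>)"

end

(* The pull count of a suboptimal arm is read off from the event that all estimates are well
  concentrated, uniformly in time. A supermartingale built from the square of the centred reward sum
  gives this event with a threshold that depends on the noise only through its variance.

  Upper bound. Let y lie slightly below the best mean. Once a suboptimal arm has about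
  sigma^2 q^2 / gap^2 pulls, where q is the (1 - 1/T)-quantile, its perturbed mean exceeds y only if
  its sample exceeds c q for some c > 1, and T P(Z > c q) tends to 0. It can then be pulled only when
  every perturbed mean, in particular that of a best arm, is at most y. The conditional probability of
  this is at most an odds ratio times the conditional probability of pulling the best arm; summed over
  the successive pulls of the best arm, the odds ratios form a convergent series, so that such rounds
  contribute O(1).

  Lower bound. Below the threshold a sample larger than q / c, together with very negative samples of
  all other arms, forces a pull. These events are independent over the rounds and do not depend on the
  past. Their number is of order T P(Z > q / c), which dominates q^2, so Chebyshev's inequality gives
  enough pulls. *)

theory Submission
  imports Defs
begin

section \<open>The sampling distribution\<close>

text \<open>The quantile \<open>q T\<close> is critical: among \<open>T\<close> samples the expected
  number above it is 1. By the ratio condition in (B2), moving it by any factor \<open>c > 1\<close>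
  makes this number tend to 0 on one side and outgrow \<open>(q T)\<^sup>2\<close>, the order of the
  pull counts, on the other. Hence both bounds meet up to a factor near 1. The room for
  \<open>c\<close> comes from raising or lowering the pull count slightly, which outweighs the small
  multiple of \<open>D\<close> given up in each gap to absorb the estimation errors.

  With only two moments of the noise, deviation probabilities cannot be summed over all rounds, so
  concentration has to come from a maximal inequality. The rounds in which an arm is pulled are
  random; the supermartingale is therefore indexed by rounds and changes only when the arm is
  pulled. In place of conditional expectations stands the product law of a fresh variable and the
  history. All constants are chosen before the probability space, on which \<open>c0\<close> may not
  depend.\<close>

locale sampling_distribution = real_distribution \<nu> for \<nu> :: "real measure" +
  assumes B1: "cond_B1 \<nu>" and B2: "cond_B2 \<nu>"
begin

lemma cdf_bounds: "0 < cdf \<nu> z" "cdf \<nu> z < 1"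
  using B1 by (auto simp: cond_B1_def)

lemma tail_bounds: "0 < tail \<nu> z" "tail \<nu> z < 1"
  using cdf_bounds[of z] by (auto simp: tail_def)

lemma tail_antimono: "x \<le> y \<Longrightarrow> tail \<nu> y \<le> tail \<nu> x"
  using cdf_nondecreasing[of x y] by (simp add: tail_def)

lemma continuous_on_cdf: "continuous_on S (cdf \<nu>)"
  using B1 unfolding cond_B1_def
  by (metis DERIV_isCont continuous_at_imp_continuous_on)

lemma continuous_on_tail: "continuous_on S (tail \<nu>)"
  unfolding tail_def[abs_def] by (intro continuous_intros continuous_on_cdf)

text \<open>Absence of atoms is what makes ties between perturbed means null events.\<close>

lemma measure_singleton: "measure \<nu> {x} = 0"
proof -
  have "isCont (cdf \<nu>) x"
    using continuous_on_cdf[of UNIV] by (simp add: continuous_on_eq_continuous_at)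
  then show ?thesis by (simp add: isCont_cdf)
qed

lemma measure_greaterThan: "measure \<nu> {x<..} = tail \<nu> x"
proof -
  have "{x<..} = space \<nu> - {..x}" by auto
  then show ?thesis
    using prob_compl[of "{..x}"] by (simp add: tail_def cdf_def)
qed

lemma tail_tendsto_0: "(tail \<nu> \<longlongrightarrow> 0) at_top"
  unfolding tail_def[abs_def] using tendsto_diff[OF tendsto_const[of 1] cdf_lim_at_top_prob] by simp

lemma tail_tendsto_1: "(tail \<nu> \<longlongrightarrow> 1) at_bot"
  unfolding tail_def[abs_def] using tendsto_diff[OF tendsto_const[of 1] cdf_lim_at_bot] by simp

text \<open>\<open>Inf\<close> on the reals is meaningful only for a nonempty set that is bounded
  below; the two limits of the tail provide this. By continuity the sublevel set is closed, so the
  infimum belongs to it, and the intermediate value theorem excludes a jump below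
  \<open>u\<close>.\<close>

lemma tail_gen_inverse:
  assumes "0 < u" "u < 1"
  shows "tail \<nu> (gen_inverse (tail \<nu>) u) = u"
proof -
  let ?S = "{x. tail \<nu> x \<le> u}"
  obtain b where b: "tail \<nu> b < u"
    using order_tendstoD(2)[OF tail_tendsto_0 assms(1)] by (metis eventually_at_top_linorder order_refl)
  obtain a where a: "\<And>x. x \<le> a \<Longrightarrow> tail \<nu> x > u"
    using order_tendstoD(1)[OF tail_tendsto_1 assms(2)] by (metis eventually_at_bot_linorder)
  have bdd: "bdd_below ?S"
    by (rule bdd_belowI[of _ a]) (use a in \<open>force simp: not_less[symmetric] intro: leI\<close>)
  have ne: "?S \<noteq> {}" using b by (auto intro!: exI[of _ b])
  have cl: "closed ?S"
    using continuous_on_tail[of UNIV] by (intro closed_Collect_le continuous_intros) auto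
  have 1: "tail \<nu> (Inf ?S) \<le> u" using closed_contains_Inf[OF ne bdd cl] by simp
  have "a \<le> b" using a[of b] b by force
  then obtain x where "tail \<nu> x = u"
    using IVT2'[of "tail \<nu>" b u a] a[of a] b continuous_on_tail by force
  moreover from this have "Inf ?S \<le> x" by (intro cInf_lower bdd) auto
  ultimately have "u \<le> tail \<nu> (Inf ?S)" using tail_antimono by metis
  with 1 show ?thesis by (simp add: gen_inverse_def)
qed

abbreviation q :: "nat \<Rightarrow> real" where
  "q T \<equiv> gen_inverse (tail \<nu>) (1 / real T)"

text \<open>At \<open>T = 1\<close> the set defining \<open>q\<close> would be the whole real
  line.\<close>

lemma tail_q: "T \<ge> 2 \<Longrightarrow> tail \<nu> (q T) = 1 / real T"
  by (intro tail_gen_inverse) auto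

lemma q_at_top: "filterlim q at_top sequentially"
  unfolding filterlim_at_top_dense
proof
  fix b
  have "(\<lambda>T. 1 / real T) \<longlonglongrightarrow> 0" by (rule lim_1_over_n)
  then have "eventually (\<lambda>T. 1 / real T < tail \<nu> b) sequentially"
    using tail_bounds(1) by (rule order_tendstoD)
  then show "eventually (\<lambda>T. b < q T) sequentially"
    using eventually_ge_at_top[of 2]
  proof eventually_elim
    case (elim T)
    then show ?case using tail_antimono[of "q T" b] tail_q[of T] by linarith
  qed
qed

lemma tail_ratio_tendsto_0:
  assumes "c > 1"
  shows "((\<lambda>z. z\<^sup>2 * tail \<nu> (c * z) / tail \<nu> z) \<longlongrightarrow> 0) at_top"
proof (rule tendsto_sandwich[OF _ _ tendsto_const])
  show "((\<lambda>z. max (ln z / (- ln (tail \<nu> z))) (z\<^sup>2 * tail \<nu> (c * z) / tail \<nu> z)) \<longlongrightarrow> 0) at_top"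
    using B2 assms by (auto simp: cond_B2_def)
  show "\<forall>\<^sub>F z in at_top. 0 \<le> z\<^sup>2 * tail \<nu> (c * z) / tail \<nu> z"
    using tail_bounds(1) by (auto intro!: always_eventually simp: less_imp_le)
qed (auto intro: always_eventually)

text \<open>The ratio condition at \<open>z = q T\<close>, where division by the tail is
  multiplication by \<open>T\<close>; the factor \<open>(q T)\<^sup>2\<close> is eventually at least
  1. It serves a union bound: in \<open>T\<close> rounds no sample exceeds
  \<open>c * q T\<close>.\<close>

lemma times_tail_tendsto_0:
  assumes "c > 1"
  shows "(\<lambda>T. real T * tail \<nu> (c * q T)) \<longlonglongrightarrow> 0"
proof (rule tendsto_sandwich[OF _ _ tendsto_const])
  show "(\<lambda>T. (q T)\<^sup>2 * tail \<nu> (c * q T) / tail \<nu> (q T)) \<longlonglongrightarrow> 0"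
    using filterlim_compose[OF tail_ratio_tendsto_0[OF assms] q_at_top] by simp
  show "\<forall>\<^sub>F T in sequentially. 0 \<le> real T * tail \<nu> (c * q T)"
    using tail_bounds(1) by (auto intro!: always_eventually simp: less_imp_le)
  have "eventually (\<lambda>T. 1 \<le> q T) sequentially"
    using q_at_top by (simp add: filterlim_at_top)
  then show "\<forall>\<^sub>F T in sequentially.
      real T * tail \<nu> (c * q T) \<le> (q T)\<^sup>2 * tail \<nu> (c * q T) / tail \<nu> (q T)"
    using eventually_ge_at_top[of 2]
  proof eventually_elim
    case (elim T)
    then have "1 \<le> (q T)\<^sup>2" by simp
    then have "1 * (real T * tail \<nu> (c * q T)) \<le> (q T)\<^sup>2 * (real T * tail \<nu> (c * q T))"
      by (intro mult_right_mono) (auto simp: less_imp_le[OF tail_bounds(1)])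
    then show ?case using elim by (simp add: tail_q ac_simps)
  qed
qed

text \<open>The same ratio condition at \<open>z = q T / c\<close>, so that \<open>c * z\<close> is
  the quantile itself. The denominator is the expected number of samples above
  \<open>q T / c\<close>, which has to supply a pull count of order
  \<open>(q T)\<^sup>2\<close>.\<close>

lemma square_over_times_tail_tendsto_0:
  assumes "c > 1"
  shows "(\<lambda>T. (q T)\<^sup>2 / (real T * tail \<nu> (q T / c))) \<longlonglongrightarrow> 0"
proof -
  have "filterlim (\<lambda>T. q T / c) at_top sequentially"
    using filterlim_tendsto_pos_mult_at_top[OF tendsto_const[of "1/c"] _ q_at_top] assms by simp
  from filterlim_compose[OF tail_ratio_tendsto_0[OF assms] this]
  have "(\<lambda>T. c\<^sup>2 * ((q T / c)\<^sup>2 * tail \<nu> (q T) / tail \<nu> (q T / c))) \<longlonglongrightarrow> 0"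
    using assms by (intro tendsto_mult_right_zero) simp
  moreover have "\<forall>\<^sub>F T in sequentially. c\<^sup>2 * ((q T / c)\<^sup>2 * tail \<nu> (q T) / tail \<nu> (q T / c)) =
      (q T)\<^sup>2 / (real T * tail \<nu> (q T / c))"
    using eventually_ge_at_top[of 2]
    by eventually_elim (use assms in \<open>simp add: tail_q power2_eq_square field_simps\<close>)
  ultimately show ?thesis by (rule Lim_transform_eventually)
qed

text \<open>(B2) makes the left tail smaller than every power. Exponent 4 is chosen because the
  argument will grow like \<open>sqrt k\<close>, which yields the summable bound
  \<open>1 / k\<^sup>2\<close>.\<close>

lemma eventually_cdf_minus_le: "\<forall>\<^sub>F z in at_top. cdf \<nu> (- z) \<le> 1 / z ^ 4"
proof -
  have "((\<lambda>z. ln z / (- ln (cdf \<nu> (- z)))) \<longlongrightarrow> 0) at_top"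
    \<comment> \<open>This limit does not involve \<open>c\<close>; 2 is an arbitrary admissible
      value.\<close>
    using B2 unfolding cond_B2_def by (elim allE[of _ 2]) simp
  then have "\<forall>\<^sub>F z in at_top. ln z / (- ln (cdf \<nu> (- z))) < 1 / 4"
    by (rule order_tendstoD) simp
  then show ?thesis using eventually_gt_at_top[of 0]
  proof eventually_elim
    case (elim z)
    have "ln (cdf \<nu> (- z)) < 0" using cdf_bounds[of "-z"] by simp
    then have "4 * ln z < - ln (cdf \<nu> (- z))" using elim by (simp add: field_simps)
    then have "ln (cdf \<nu> (- z)) \<le> ln (1 / z ^ 4)"
      using elim by (simp add: ln_div ln_realpow)
    then show ?case using elim cdf_bounds[of "-z"] by (subst (asm) ln_le_cancel_iff) auto
  qed
qed

lemma summable_cdf_ratio: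
  assumes "x > 0"
  shows "summable (\<lambda>k::nat. cdf \<nu> (- (x * sqrt k)) / tail \<nu> (- (x * sqrt k)))"
proof (rule summable_comparison_test_ev)
  have "filterlim (\<lambda>k::nat. x * sqrt k) at_top sequentially"
    using filterlim_tendsto_pos_mult_at_top[OF tendsto_const[of x] assms
        filterlim_compose[OF sqrt_at_top filterlim_real_sequentially]] .
  from eventually_compose_filterlim[OF eventually_cdf_minus_le this]
  show "\<forall>\<^sub>F k::nat in sequentially. norm (cdf \<nu> (- (x * sqrt k)) / tail \<nu> (- (x * sqrt k)))
      \<le> 1 / (tail \<nu> 0 * x ^ 4) * (1 / real k ^ 2)"
  proof eventually_elim
    case (elim k)
    have "sqrt k ^ 4 = (sqrt k ^ 2) ^ 2" by (subst power_mult[symmetric]) simp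
    then have sq: "(x * sqrt k) ^ 4 = x ^ 4 * real k ^ 2" by (simp add: power_mult_distrib)
    have "cdf \<nu> (- (x * sqrt k)) / tail \<nu> (- (x * sqrt k)) \<le> (1 / (x * sqrt k) ^ 4) / tail \<nu> 0"
      using elim assms by (intro frac_le tail_antimono) (auto simp: tail_bounds)
    then show ?case
      using sq less_imp_le[OF cdf_bounds(1)] less_imp_le[OF tail_bounds(1)] by (simp add: ac_simps)
  qed
  show "summable (\<lambda>k::nat. 1 / (tail \<nu> 0 * x ^ 4) * (1 / real k ^ 2))"
    using inverse_power_summable[of 2, where ?'a = real]
    by (intro summable_mult) (simp add: inverse_eq_divide)
qed

end

section \<open>Completed histories of independent families\<close>

context prob_space
begin

text \<open>The completion by null sets is needed because ties may be broken using the future, so that the arm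
  pulled is a function of the past only almost surely.\<close>

definition history :: "('i \<Rightarrow> 'a \<Rightarrow> real) \<Rightarrow> 'i set \<Rightarrow> 'a measure" where
  "history X I = sigma (space M)
     {B \<in> events. \<exists>C\<in>sets (PiM I (\<lambda>_. borel)). AE \<omega> in M. \<omega> \<in> B \<longleftrightarrow> (\<lambda>i\<in>I. X i \<omega>) \<in> C}"

lemma space_history [simp]: "space (history X I) = space M"
  unfolding history_def by (rule space_measure_of) (auto dest: sets.sets_into_space)

text \<open>The generating collection is already a sigma-algebra, so membership in it can be
  unfolded directly.\<close>

lemma sets_history:
  "sets (history X I) =
     {B \<in> events. \<exists>C\<in>sets (PiM I (\<lambda>_. borel)). AE \<omega> in M. \<omega> \<in> B \<longleftrightarrow> (\<lambda>i\<in>I. X i \<omega>) \<in> C}"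
    (is "_ = ?S")
proof -
  have "sigma_algebra (space M) ?S"
  proof (rule sigma_algebra_iff2[THEN iffD2], intro conjI allI impI ballI)
    show "?S \<subseteq> Pow (space M)" using sets.sets_into_space by auto
    show "{} \<in> ?S" by (auto intro!: bexI[of _ "{}"])
  next
    fix B assume "B \<in> ?S"
    then obtain C where B: "B \<in> events" and C: "C \<in> sets (PiM I (\<lambda>_. borel))"
      and AE: "AE \<omega> in M. \<omega> \<in> B \<longleftrightarrow> (\<lambda>i\<in>I. X i \<omega>) \<in> C" by auto
    have "AE \<omega> in M. \<omega> \<in> space M - B \<longleftrightarrow> (\<lambda>i\<in>I. X i \<omega>) \<in> space (PiM I (\<lambda>_. borel)) - C"
      using AE AE_space by eventually_elim (auto simp: space_PiM)
    then show "space M - B \<in> ?S" using B C by (blast intro: sets.compl_sets)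
  next
    fix B :: "nat \<Rightarrow> 'a set" assume "range B \<subseteq> ?S"
    then have *: "B n \<in> ?S" for n by (rule subsetD) (rule rangeI)
    then have B: "B n \<in> events" for n by simp
    have "\<forall>n. \<exists>C. C \<in> sets (PiM I (\<lambda>_. borel)) \<and>
        (AE \<omega> in M. \<omega> \<in> B n \<longleftrightarrow> (\<lambda>i\<in>I. X i \<omega>) \<in> C)"
      using * by simp blast
    from choice[OF this] obtain C where C: "C n \<in> sets (PiM I (\<lambda>_. borel))"
      and AE: "AE \<omega> in M. \<omega> \<in> B n \<longleftrightarrow> (\<lambda>i\<in>I. X i \<omega>) \<in> C n" for n by blast
    have "AE \<omega> in M. \<forall>n. \<omega> \<in> B n \<longleftrightarrow> (\<lambda>i\<in>I. X i \<omega>) \<in> C n"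
      using AE by (simp add: AE_all_countable)
    then have "AE \<omega> in M. \<omega> \<in> (\<Union>n. B n) \<longleftrightarrow> (\<lambda>i\<in>I. X i \<omega>) \<in> (\<Union>n. C n)"
      by eventually_elim auto
    then show "(\<Union>n. B n) \<in> ?S" using B C by (blast intro: sets.countable_UN)
  qed
  then show ?thesis by (simp add: history_def sigma_algebra.sets_measure_of_eq)
qed

lemma measurable_history_imp_measurable:
  "f \<in> measurable (history X I) N \<Longrightarrow> f \<in> measurable M N"
  by (auto simp: measurable_def sets_history)

text \<open>The benefit of the completion: the event of pulling an arm can be exchanged for the
  event that its perturbed mean is maximal.\<close>

lemma history_AE_eqI:
  assumes "B \<in> sets (history X I)" "B' \<in> events" "AE \<omega> in M. \<omega> \<in> B' \<longleftrightarrow> \<omega> \<in> B"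
  shows "B' \<in> sets (history X I)"
proof -
  obtain C where "C \<in> sets (PiM I (\<lambda>_. borel))" "AE \<omega> in M. \<omega> \<in> B \<longleftrightarrow> (\<lambda>i\<in>I. X i \<omega>) \<in> C"
    using assms(1) by (auto simp: sets_history)
  moreover from this(2) assms(3) have "AE \<omega> in M. \<omega> \<in> B' \<longleftrightarrow> (\<lambda>i\<in>I. X i \<omega>) \<in> C"
    by eventually_elim auto
  ultimately show ?thesis using assms(2) by (auto simp: sets_history)
qed

lemma sets_history_mono:
  assumes "I \<subseteq> J"
  shows "sets (history X I) \<subseteq> sets (history X J)"
proof
  fix B assume "B \<in> sets (history X I)"
  then obtain C where B: "B \<in> events" and C: "C \<in> sets (PiM I (\<lambda>_. borel))"
    and AE: "AE \<omega> in M. \<omega> \<in> B \<longleftrightarrow> (\<lambda>i\<in>I. X i \<omega>) \<in> C" by (auto simp: sets_history)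
  let ?C = "(\<lambda>x. restrict x I) -` C \<inter> space (PiM J (\<lambda>_. borel :: real measure))"
  have "?C \<in> sets (PiM J (\<lambda>_. borel))"
    by (rule measurable_sets[OF measurable_restrict_subset[OF assms] C])
  moreover have "(\<lambda>i\<in>J. X i \<omega>) \<in> ?C \<longleftrightarrow> (\<lambda>i\<in>I. X i \<omega>) \<in> C" for \<omega>
    using assms by (auto simp: space_PiM restrict_restrict Int_absorb1)
  ultimately show "B \<in> sets (history X J)"
    using B AE unfolding sets_history by (intro CollectI conjI bexI[of _ ?C]) simp_all
qed

lemma measurable_history_mono:
  assumes "f \<in> measurable (history X I) N" "I \<subseteq> J"
  shows "f \<in> measurable (history X J) N"
  using assms(1) sets_history_mono[OF assms(2), of X] by (auto simp: measurable_def)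

lemma measurable_history_component:
  assumes "i \<in> I" "X i \<in> borel_measurable M"
  shows "X i \<in> borel_measurable (history X I)"
proof (rule measurableI)
  fix B :: "real set" assume B: "B \<in> sets borel"
  let ?C = "(\<lambda>x. x i) -` B \<inter> space (PiM I (\<lambda>_. borel :: real measure))"
  have "?C \<in> sets (PiM I (\<lambda>_. borel))"
    by (rule measurable_sets[OF measurable_component_singleton[OF assms(1)] B])
  moreover have "(\<lambda>i\<in>I. X i \<omega>) \<in> ?C \<longleftrightarrow> X i \<omega> \<in> B" for \<omega>
    using assms(1) by (auto simp: space_PiM)
  ultimately show "X i -` B \<inter> space (history X I) \<in> sets (history X I)"
    using measurable_sets[OF assms(2) B] by (auto simp: sets_history intro!: bexI[of _ ?C])
qed simp

text \<open>Up to a null set, \<open>a\<close> is the preimage of a set in the coordinates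
  \<open>I\<close>; for this preimage the independence of the disjoint blocks \<open>I\<close> and
  \<open>{i}\<close> applies.\<close>

lemma prob_history_Int:
  assumes indep: "indep_vars (\<lambda>_. borel) X J" and I: "I \<subseteq> J" and i: "i \<in> J" "i \<notin> I"
    and a: "a \<in> sets (history X I)" and B: "B \<in> sets borel"
  shows "prob (a \<inter> (X i -` B \<inter> space M)) = prob a * prob (X i -` B \<inter> space M)"
proof -
  have X: "X j \<in> borel_measurable M" if "j \<in> J" for j
    using indep that by (auto simp: indep_vars_def)
  obtain C where a_ev: "a \<in> events" and C: "C \<in> sets (PiM I (\<lambda>_. borel))"
    and AE: "AE \<omega> in M. \<omega> \<in> a \<longleftrightarrow> (\<lambda>i\<in>I. X i \<omega>) \<in> C"
    using a by (auto simp: sets_history)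
  let ?a = "(\<lambda>\<omega>. \<lambda>j\<in>I. X j \<omega>) -` C \<inter> space M"
  let ?b = "X i -` B \<inter> space M"
  let ?B = "(\<lambda>x. x i) -` B \<inter> space (PiM {i} (\<lambda>_. borel :: real measure))"
  have "?a \<in> events"
    using measurable_sets[OF measurable_restrict C] I X by blast
  moreover have "?b \<in> events" using measurable_sets[OF X B] i by auto
  ultimately have "prob (a \<inter> ?b) = prob (?a \<inter> ?b)" "prob ?a = prob a"
    using AE a_ev by (auto intro!: measure_eq_AE)
  moreover have "prob (?a \<inter> ?b) = prob ?a * prob ?b"
  proof -
    have "(\<lambda>x. x i) \<in> borel_measurable (PiM {i} (\<lambda>_. borel :: real measure))"
      by (rule measurable_component_singleton) simp
    then have "?B \<in> sets (PiM {i} (\<lambda>_. borel))" by (rule measurable_sets[OF _ B])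
    then have "prob ((\<lambda>\<omega>. (\<lambda>j\<in>I. X j \<omega>, \<lambda>j\<in>{i}. X j \<omega>)) -` (C \<times> ?B) \<inter> space M) =
        prob ?a * prob ((\<lambda>\<omega>. \<lambda>j\<in>{i}. X j \<omega>) -` ?B \<inter> space M)"
      using indep_varD[OF indep_var_restrict[OF indep, of I "{i}"] C] I i by auto
    moreover have "(\<lambda>\<omega>. (\<lambda>j\<in>I. X j \<omega>, \<lambda>j\<in>{i}. X j \<omega>)) -` (C \<times> ?B) \<inter> space M = ?a \<inter> ?b"
      by (auto simp: space_PiM)
    moreover have "(\<lambda>\<omega>. \<lambda>j\<in>{i}. X j \<omega>) -` ?B \<inter> space M = ?b"
      by (auto simp: space_PiM)
    ultimately show ?thesis by simp
  qed
  ultimately show ?thesis by simp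
qed

text \<open>Rectangles determine a product measure, and on them the claim is
  \<open>prob_history_Int\<close>.\<close>

lemma distr_pair_history:
  assumes indep: "indep_vars (\<lambda>_. borel) X J" and I: "I \<subseteq> J" and i: "i \<in> J" "i \<notin> I"
    and f: "f \<in> measurable (history X I) N"
  shows "distr M N f \<Otimes>\<^sub>M distr M borel (X i) = distr M (N \<Otimes>\<^sub>M borel) (\<lambda>\<omega>. (f \<omega>, X i \<omega>))"
proof -
  have X [measurable]: "X i \<in> borel_measurable M"
    using indep i by (auto simp: indep_vars_def)
  have fM [measurable]: "f \<in> measurable M N" using f by (rule measurable_history_imp_measurable)
  interpret f: prob_space "distr M N f" by (rule prob_space_distr) (rule fM)
  interpret Y: prob_space "distr M borel (X i)" by (rule prob_space_distr) (rule X)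
  show ?thesis
  proof (rule pair_measure_eqI)
    fix C B assume C: "C \<in> sets (distr M N f)" and B: "B \<in> sets (distr M borel (X i))"
    have "f -` C \<inter> space M \<in> sets (history X I)" using measurable_sets[OF f, of C] C by simp
    from prob_history_Int[OF indep I i this, of B]
    have "prob ((f -` C \<inter> space M) \<inter> (X i -` B \<inter> space M)) =
        prob (f -` C \<inter> space M) * prob (X i -` B \<inter> space M)" using B by simp
    moreover have "(f -` C \<inter> space M) \<inter> (X i -` B \<inter> space M) =
        (\<lambda>\<omega>. (f \<omega>, X i \<omega>)) -` (C \<times> B) \<inter> space M" by auto
    ultimately show "emeasure (distr M N f) C * emeasure (distr M borel (X i)) B =
        emeasure (distr M (N \<Otimes>\<^sub>M borel) (\<lambda>\<omega>. (f \<omega>, X i \<omega>))) (C \<times> B)"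
      using C B by (simp add: emeasure_distr emeasure_eq_measure ennreal_mult)
  qed (auto intro: f.sigma_finite_measure_axioms Y.sigma_finite_measure_axioms
      cong: sets_pair_measure_cong)
qed

lemma indep_var_history:
  fixes f :: "'a \<Rightarrow> real"
  assumes "indep_vars (\<lambda>_. borel) X J" "I \<subseteq> J" "i \<in> J" "i \<notin> I" "f \<in> borel_measurable (history X I)"
  shows "indep_var borel f borel (X i)"
  using distr_pair_history[OF assms] measurable_history_imp_measurable[OF assms(5)] assms(1,3)
  by (auto simp: indep_var_distribution_eq indep_vars_def)

text \<open>Plays the role of conditioning on the history: \<open>f\<close> is frozen and the fresh
  coordinate is integrated out. The target space of \<open>f\<close> is left general so that
  \<open>f\<close> can be a pair of a weight and a threshold.\<close>

lemma nn_integral_history: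
  assumes indep: "indep_vars (\<lambda>_. borel) X J" and I: "I \<subseteq> J" and i: "i \<in> J" "i \<notin> I"
    and f: "f \<in> measurable (history X I) N"
    and h: "case_prod h \<in> borel_measurable (N \<Otimes>\<^sub>M borel)"
  shows "(\<integral>\<^sup>+\<omega>. h (f \<omega>) (X i \<omega>) \<partial>M) = (\<integral>\<^sup>+\<omega>. (\<integral>\<^sup>+z. h (f \<omega>) z \<partial>distr M borel (X i)) \<partial>M)"
proof -
  have X [measurable]: "X i \<in> borel_measurable M"
    using indep i by (auto simp: indep_vars_def)
  have fM [measurable]: "f \<in> measurable M N" using f by (rule measurable_history_imp_measurable)
  interpret Y: prob_space "distr M borel (X i)" by (rule prob_space_distr) (rule X)
  have "sets (N \<Otimes>\<^sub>M borel) = sets (distr M N f \<Otimes>\<^sub>M distr M borel (X i))"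
    by (intro sets_pair_measure_cong) simp_all
  then have h': "case_prod h \<in> borel_measurable (distr M N f \<Otimes>\<^sub>M distr M borel (X i))"
    using h measurable_cong_sets by blast
  have "(\<integral>\<^sup>+\<omega>. h (f \<omega>) (X i \<omega>) \<partial>M) =
      (\<integral>\<^sup>+x. case_prod h x \<partial>distr M (N \<Otimes>\<^sub>M borel) (\<lambda>\<omega>. (f \<omega>, X i \<omega>)))"
    using h by (subst nn_integral_distr) auto
  also have "distr M (N \<Otimes>\<^sub>M borel) (\<lambda>\<omega>. (f \<omega>, X i \<omega>)) = distr M N f \<Otimes>\<^sub>M distr M borel (X i)"
    using distr_pair_history[OF indep I i f] by simp
  also have "(\<integral>\<^sup>+x. case_prod h x \<partial>(distr M N f \<Otimes>\<^sub>M distr M borel (X i))) =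
      (\<integral>\<^sup>+x. (\<integral>\<^sup>+z. h x z \<partial>distr M borel (X i)) \<partial>distr M N f)"
    using h' by (subst Y.nn_integral_fst[symmetric]) auto
  also have "\<dots> = (\<integral>\<^sup>+\<omega>. (\<integral>\<^sup>+z. h (f \<omega>) z \<partial>distr M borel (X i)) \<partial>M)"
    using Y.borel_measurable_nn_integral[OF h'] by (subst nn_integral_distr) auto
  finally show ?thesis .
qed

text \<open>After integrating out the fresh coordinate, the event of equality is a single point,
  which has mass 0.\<close>

lemma AE_history_neq:
  assumes indep: "indep_vars (\<lambda>_. borel) X J" and I: "I \<subseteq> J" and i: "i \<in> J" "i \<notin> I"
    and U: "U \<in> borel_measurable (history X I)"
    and null: "\<And>x. measure (distr M borel (X i)) {x} = 0"
  shows "AE \<omega> in M. X i \<omega> \<noteq> U \<omega>"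
proof -
  have [measurable]: "X i \<in> borel_measurable M" "U \<in> borel_measurable M"
    using indep i measurable_history_imp_measurable[OF U] by (auto simp: indep_vars_def)
  interpret Y: prob_space "distr M borel (X i)" by (rule prob_space_distr) measurable
  let ?E = "{\<omega> \<in> space M. X i \<omega> = U \<omega>}"
  have "emeasure M ?E = (\<integral>\<^sup>+\<omega>. indicator ?E \<omega> \<partial>M)"
    by (rule nn_integral_indicator[symmetric]) measurable
  also have "\<dots> = (\<integral>\<^sup>+\<omega>. indicator {(u, z). z = u} (U \<omega>, X i \<omega>) \<partial>M)"
    by (rule nn_integral_cong) (simp add: indicator_def)
  also have "\<dots> = (\<integral>\<^sup>+\<omega>. (\<integral>\<^sup>+z. indicator {(u, z). z = u} (U \<omega>, z) \<partial>distr M borel (X i)) \<partial>M)"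
    by (rule nn_integral_history[OF indep I i U]) measurable
  also have "\<dots> = (\<integral>\<^sup>+\<omega>. emeasure (distr M borel (X i)) {U \<omega>} \<partial>M)"
  proof (rule nn_integral_cong)
    fix \<omega>
    have "(\<integral>\<^sup>+z. indicator {(u, z). z = u} (U \<omega>, z) \<partial>distr M borel (X i)) =
        (\<integral>\<^sup>+z. indicator {U \<omega>} z \<partial>distr M borel (X i))"
      by (rule nn_integral_cong) (simp add: indicator_def)
    then show "(\<integral>\<^sup>+z. indicator {(u, z). z = u} (U \<omega>, z) \<partial>distr M borel (X i)) =
        emeasure (distr M borel (X i)) {U \<omega>}" by simp
  qed
  also have "\<dots> = 0"
    using null by (simp add: Y.emeasure_eq_measure)
  finally show ?thesis by (subst AE_iff_measurable[OF _ refl]) auto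
qed

end

section \<open>Adaptedness of a run\<close>

lemma nbar_eq_Suc: "\<exists>k. nbar A a t = real (Suc k)"
proof (induction t)
  case (Suc t)
  then obtain k where k: "nbar A a t = real (Suc k)" by blast
  show ?case
    by (cases "A (Suc t) = a") (auto simp: k intro!: exI[of _ k] exI[of _ "Suc k"])
qed (auto intro!: exI[of _ 0])

lemma nbar_ge_1: "1 \<le> nbar A a t"
  using nbar_eq_Suc[of A a t] by auto

lemma nbar_mono: "s \<le> t \<Longrightarrow> nbar A a s \<le> nbar A a t"
  by (induction t) (auto simp: le_Suc_eq intro: add_increasing2)

lemma nbar_eq_pulls: "nbar A a t = 1 + pulls A a t"
  by (induction t) (auto simp: pulls_def)

lemma measurable_nbar:
  assumes "\<And>s. 1 \<le> s \<Longrightarrow> s \<le> t \<Longrightarrow> A s \<in> measurable F (count_space UNIV)"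
  shows "(\<lambda>\<omega>. nbar (\<lambda>s. A s \<omega>) a t) \<in> borel_measurable F"
  using assms
proof (induction t)
  case (Suc t)
  have [measurable]: "A (Suc t) \<in> measurable F (count_space UNIV)" using Suc.prems by simp
  have [measurable]: "(\<lambda>\<omega>. nbar (\<lambda>s. A s \<omega>) a t) \<in> borel_measurable F"
    using Suc by simp
  show ?case by simp
qed simp

lemma measurable_mubar:
  assumes "\<And>s. 1 \<le> s \<Longrightarrow> s \<le> t \<Longrightarrow> A s \<in> measurable F (count_space UNIV)"
    and "\<And>s. 1 \<le> s \<Longrightarrow> s \<le> t \<Longrightarrow> R s \<in> borel_measurable F"
  shows "(\<lambda>\<omega>. mubar (\<lambda>s. A s \<omega>) (\<lambda>s. R s \<omega>) a t) \<in> borel_measurable F"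
  using assms
proof (induction t)
  case (Suc t)
  have [measurable]: "A (Suc t) \<in> measurable F (count_space UNIV)" "R (Suc t) \<in> borel_measurable F"
    using Suc.prems by simp_all
  have [measurable]: "(\<lambda>\<omega>. nbar (\<lambda>s. A s \<omega>) a t) \<in> borel_measurable F"
    "(\<lambda>\<omega>. mubar (\<lambda>s. A s \<omega>) (\<lambda>s. R s \<omega>) a t) \<in> borel_measurable F"
    using Suc by (simp_all add: measurable_nbar)
  show ?case by simp
qed simp

locale thompson_run =
  thompson_sampling M K \<mu> \<sigma> \<nu> \<xi> Z A + law: sampling_distribution \<nu>
  for M :: "'w measure" and K \<mu> \<sigma> \<nu> \<xi> Z A +
  assumes sigma_pos: "\<sigma> > 0"
begin

abbreviation arms :: "nat set" where "arms \<equiv> {1..K}"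

abbreviation n :: "nat \<Rightarrow> nat \<Rightarrow> 'w \<Rightarrow> real" where
  "n a t \<omega> \<equiv> nbar (\<lambda>s. A s \<omega>) a t"

definition estimate :: "nat \<Rightarrow> nat \<Rightarrow> 'w \<Rightarrow> real" where
  "estimate a t \<omega> = mubar (\<lambda>s. A s \<omega>) (\<lambda>s. \<mu> (A s \<omega>) + \<sigma> * \<xi> s \<omega>) a t"

text \<open>The sum of the noise received by arm \<open>a\<close>, scaled by \<sigma>, minus
  \<open>\<mu> a\<close>. The last term is the bias of the fictitious initial observation 0, which
  \<open>nbar\<close> counts.\<close>

definition dev :: "nat \<Rightarrow> nat \<Rightarrow> 'w \<Rightarrow> real" where
  "dev a t \<omega> = n a t \<omega> * (estimate a t \<omega> - \<mu> a)"

text \<open>The perturbed mean compared in round \<open>Suc t\<close>.\<close>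

definition index :: "nat \<Rightarrow> nat \<Rightarrow> 'w \<Rightarrow> real" where
  "index a t \<omega> = estimate a t \<omega> + \<sigma> / sqrt (n a t \<omega>) * Z a (Suc t) \<omega>"

definition X :: "nat + nat \<times> nat \<Rightarrow> 'w \<Rightarrow> real" where
  "X i = (case i of Inl t \<Rightarrow> \<xi> t | Inr (a, t) \<Rightarrow> Z a t)"

definition past :: "nat \<Rightarrow> (nat + nat \<times> nat) set" where
  "past t = {1..t} <+> (arms \<times> {1..t})"

text \<open>Lies between \<open>past t\<close> and \<open>past (Suc t)\<close>: the samples of round
  \<open>Suc t\<close> are revealed, its noise is not. At this stage the arm is determined while the
  noise is still fresh.\<close>

definition round :: "nat \<Rightarrow> (nat + nat \<times> nat) set" where
  "round t = {1..t} <+> (arms \<times> {1..Suc t})"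

definition sources :: "(nat + nat \<times> nat) set" where
  "sources = {1..} <+> (arms \<times> {1..})"

lemma mem_sources [simp]:
  "Inl s \<in> sources \<longleftrightarrow> 1 \<le> s" "Inr (a, s) \<in> sources \<longleftrightarrow> a \<in> arms \<and> 1 \<le> s"
  by (auto simp: sources_def Plus_def)

lemma mem_past [simp]:
  "Inl s \<in> past t \<longleftrightarrow> 1 \<le> s \<and> s \<le> t" "Inr (a, s) \<in> past t \<longleftrightarrow> a \<in> arms \<and> 1 \<le> s \<and> s \<le> t"
  by (auto simp: past_def Plus_def)

lemma mem_round [simp]:
  "Inl s \<in> round t \<longleftrightarrow> 1 \<le> s \<and> s \<le> t"
  "Inr (a, s) \<in> round t \<longleftrightarrow> a \<in> arms \<and> 1 \<le> s \<and> s \<le> Suc t"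
  by (auto simp: round_def Plus_def)

lemma indep_X: "indep_vars (\<lambda>_. borel) X sources"
proof -
  have "X = (\<lambda>i. case i of Inl t \<Rightarrow> \<xi> t | Inr (a, t) \<Rightarrow> Z a t)"
    by (simp add: X_def fun_eq_iff split: sum.split)
  then show ?thesis using indep by (simp add: sources_def)
qed

lemma measurable_X [measurable]: "i \<in> sources \<Longrightarrow> X i \<in> borel_measurable M"
  using indep_X by (auto simp: indep_vars_def)

lemma past_subset: "past t \<subseteq> round t" "round t \<subseteq> past (Suc t)" "round t \<subseteq> sources"
  by (auto simp: past_def round_def sources_def)

lemma past_mono: "s \<le> t \<Longrightarrow> past s \<subseteq> past t"
  by (auto simp: past_def)

lemma arm_in_arms: "\<omega> \<in> space M \<Longrightarrow> A (Suc t) \<omega> \<in> arms"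
  using arm_selection[of "Suc t" \<omega>] by (simp add: is_arg_max_def)

lemma index_le_index_arm:
  assumes "\<omega> \<in> space M" "b \<in> arms"
  shows "index b t \<omega> \<le> index (A (Suc t) \<omega>) t \<omega>"
proof -
  have *: "n a t \<omega> powr - (1 / 2) = 1 / sqrt (n a t \<omega>)" for a
    using nbar_ge_1[of "\<lambda>s. A s \<omega>" a t]
    by (simp add: powr_minus_divide powr_half_sqrt)
  show ?thesis
    using arm_selection[of "Suc t" \<omega>] assms
    unfolding is_arg_max_linorder by (simp add: index_def estimate_def *)
qed

lemma estimate_eq: "estimate a t \<omega> = \<mu> a + dev a t \<omega> / n a t \<omega>"
  using nbar_ge_1[of "\<lambda>s. A s \<omega>" a t] by (simp add: dev_def)

lemma dev_0: "dev a 0 \<omega> = - \<mu> a"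
  by (simp add: dev_def estimate_def)

lemma dev_Suc: "dev a (Suc t) \<omega> = dev a t \<omega> + of_bool (A (Suc t) \<omega> = a) * \<sigma> * \<xi> (Suc t) \<omega>"
  using nbar_ge_1[of "\<lambda>s. A s \<omega>" a t] by (simp add: dev_def estimate_def field_simps)

text \<open>Adaptedness of the arms is a hypothesis here because the lemma is used inside the
  induction that proves it.\<close>

lemma measurable_past_n_estimate:
  assumes "\<And>s. 1 \<le> s \<Longrightarrow> s \<le> t \<Longrightarrow> A s \<in> measurable (history X (past t)) (count_space UNIV)"
  shows "n a t \<in> borel_measurable (history X (past t))"
    and "estimate a t \<in> borel_measurable (history X (past t))"
proof -
  show "n a t \<in> borel_measurable (history X (past t))"
    by (rule measurable_nbar) (rule assms)
  have "(\<lambda>\<omega>. \<mu> (A s \<omega>) + \<sigma> * \<xi> s \<omega>) \<in> borel_measurable (history X (past t))" if "1 \<le> s" "s \<le> t" for s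
  proof -
    note [measurable] = assms[OF that]
    have "X (Inl s) \<in> borel_measurable (history X (past t))"
      by (rule measurable_history_component) (use that in auto)
    then have [measurable]: "\<xi> s \<in> borel_measurable (history X (past t))" by (simp add: X_def)
    show ?thesis by measurable
  qed
  then show "estimate a t \<in> borel_measurable (history X (past t))"
    unfolding estimate_def[abs_def] by (intro measurable_mubar assms) auto
qed

lemma measurable_Z_history:
  assumes "Inr (a, s) \<in> I" "I \<subseteq> sources"
  shows "Z a s \<in> borel_measurable (history X I)"
proof -
  have "X (Inr (a, s)) \<in> borel_measurable (history X I)"
    by (rule measurable_history_component) (use assms in auto)
  then show ?thesis by (simp add: X_def)
qed

lemma distr_X_Z: "Inr (a, s) \<in> sources \<Longrightarrow> distr M borel (X (Inr (a, s))) = \<nu>"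
  using sampling_law[of a s] by (simp add: X_def)

text \<open>Induction over the rounds. Given the past, two perturbed means of a round coincide with
  probability 0, so almost surely the maximizer is unique and is a function of
  \<open>round t\<close>, however ties are broken.\<close>

lemma measurable_arm_history:
  "1 \<le> s \<Longrightarrow> s \<le> t \<Longrightarrow> A s \<in> measurable (history X (past t)) (count_space UNIV)"
  "A (Suc t) \<in> measurable (history X (round t)) (count_space UNIV)"
proof -
  have step: "A (Suc t) \<in> measurable (history X (round t)) (count_space UNIV)"
    if IH: "\<And>s. 1 \<le> s \<Longrightarrow> s \<le> t \<Longrightarrow> A s \<in> measurable (history X (past t)) (count_space UNIV)" for t
  proof -
    have past: "n a t \<in> borel_measurable (history X (past t))"
      "estimate a t \<in> borel_measurable (history X (past t))" for a
      by (rule measurable_past_n_estimate, rule IH; assumption)+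
    \<comment> \<open>The index set is kept general: it is used for \<open>round t\<close> and for
      \<open>round t\<close> with one sample removed.\<close>
    have idx: "index b t \<in> borel_measurable (history X I)"
      if "past t \<subseteq> I" "I \<subseteq> sources" "Inr (b, Suc t) \<in> I" for b I
    proof -
      note [measurable] = past[THEN measurable_history_mono, OF that(1)] measurable_Z_history[OF that(3,2)]
      show ?thesis unfolding index_def[abs_def] by measurable
    qed
    have ties: "AE \<omega> in M. index a t \<omega> \<noteq> index b t \<omega>" if ab: "a \<in> arms" "b \<in> arms" "a \<noteq> b" for a b
    proof -
      \<comment> \<open>Everything except the sample of arm \<open>a\<close>: the perturbed mean of
        \<open>b\<close> is still known, and a tie prescribes a single value for the missing
        sample.\<close>
      let ?I = "round t - {Inr (a, Suc t)}"
      have sub: "past t \<subseteq> ?I" "?I \<subseteq> sources" by (auto simp: past_def round_def sources_def)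
      note [measurable] = past[THEN measurable_history_mono, OF sub(1)]
      have [measurable]: "index b t \<in> borel_measurable (history X ?I)"
        using ab by (intro idx sub) auto
      have "AE \<omega> in M. X (Inr (a, Suc t)) \<omega> \<noteq> (index b t \<omega> - estimate a t \<omega>) * sqrt (n a t \<omega>) / \<sigma>"
        by (rule AE_history_neq[OF indep_X sub(2)])
          (use ab in \<open>auto simp: distr_X_Z law.measure_singleton\<close>)
      then show ?thesis
      proof eventually_elim
        case (elim \<omega>)
        then show ?case using sigma_pos nbar_ge_1[of "\<lambda>s. A s \<omega>" a t]
          by (auto simp: X_def index_def field_simps)
      qed
    qed
    have "AE \<omega> in M. \<forall>a\<in>arms. \<forall>b\<in>arms. a \<noteq> b \<longrightarrow> index a t \<omega> \<noteq> index b t \<omega>"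
      using ties by (auto simp: AE_finite_all)
    then have no_ties: "AE \<omega> in M. \<forall>a\<in>arms. \<forall>b\<in>arms. index a t \<omega> = index b t \<omega> \<longrightarrow> a = b"
      by eventually_elim blast
    show ?thesis
    proof (subst measurable_count_space_eq2_countable, safe)
      fix a
      have meas: "A (Suc t) -` {a} \<inter> space M \<in> events"
        by (rule measurable_sets[OF arm_measurable]) auto
      show "A (Suc t) -` {a} \<inter> space (history X (round t)) \<in> sets (history X (round t))"
      proof (cases "a \<in> arms")
        case True
        let ?E = "{\<omega> \<in> space (history X (round t)). \<forall>b\<in>arms. index b t \<omega> \<le> index a t \<omega>}"
        have [measurable]: "index b t \<in> borel_measurable (history X (round t))" if "b \<in> arms" for b
          using that by (intro idx past_subset) auto
        have "?E \<in> sets (history X (round t))"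
          using True by measurable
        moreover have "AE \<omega> in M. \<omega> \<in> A (Suc t) -` {a} \<inter> space M \<longleftrightarrow> \<omega> \<in> ?E"
          using no_ties AE_space
        proof eventually_elim
          case (elim \<omega>)
          then have arm: "A (Suc t) \<omega> \<in> arms"
            and le: "\<And>b. b \<in> arms \<Longrightarrow> index b t \<omega> \<le> index (A (Suc t) \<omega>) t \<omega>"
            using arm_in_arms index_le_index_arm by blast+
          have "A (Suc t) \<omega> = a" if "\<And>b. b \<in> arms \<Longrightarrow> index b t \<omega> \<le> index a t \<omega>"
            using elim(1) arm True antisym[OF that[OF arm] le[OF True]] by blast
          then show ?case using le elim(2) by auto
        qed
        ultimately show ?thesis
          unfolding space_history by (rule history_AE_eqI[OF _ meas])
      next
        case False
        then have "A (Suc t) -` {a} \<inter> space (history X (round t)) = {}" using arm_in_arms by auto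
        then show ?thesis by (metis sets.empty_sets)
      qed
    qed auto
  qed
  have *: "A s \<in> measurable (history X (past t)) (count_space UNIV)" if "1 \<le> s" "s \<le> t" for s t
    using that
  proof (induction t arbitrary: s)
    case (Suc t)
    show ?case
    proof (cases "s \<le> t")
      case True
      show ?thesis by (rule measurable_history_mono[OF Suc.IH[OF Suc.prems(1) True] past_mono]) simp
    next
      case False
      then have "s = Suc t" using Suc.prems by simp
      then show ?thesis
        by (simp only:) (rule measurable_history_mono[OF step[OF Suc.IH] past_subset(2)])
    qed
  qed simp
  then show "1 \<le> s \<Longrightarrow> s \<le> t \<Longrightarrow> A s \<in> measurable (history X (past t)) (count_space UNIV)" .
  from * show "A (Suc t) \<in> measurable (history X (round t)) (count_space UNIV)" by (rule step)
qed

lemma measurable_past: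
  "n a t \<in> borel_measurable (history X (past t))"
  "estimate a t \<in> borel_measurable (history X (past t))"
  by (rule measurable_past_n_estimate, rule measurable_arm_history(1); assumption)+

lemma measurable_dev_past: "dev a t \<in> borel_measurable (history X (past t))"
proof -
  note [measurable] = measurable_past
  show ?thesis unfolding dev_def[abs_def] by measurable
qed

lemmas measurable_run [measurable] =
  measurable_past[THEN measurable_history_imp_measurable]
  measurable_dev_past[THEN measurable_history_imp_measurable]
  measurable_arm_history(2)[THEN measurable_history_imp_measurable]

lemma measurable_Z [measurable]: "a \<in> arms \<Longrightarrow> Z a (Suc t) \<in> borel_measurable M"
  using measurable_X[of "Inr (a, Suc t)"] by (simp add: X_def)

lemma measurable_noise [measurable]: "\<xi> (Suc t) \<in> borel_measurable M"
  using measurable_X[of "Inl (Suc t)"] by (simp add: X_def)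

lemma measurable_index [measurable]: "a \<in> arms \<Longrightarrow> index a t \<in> borel_measurable M"
  unfolding index_def[abs_def] by measurable

lemma noise_moments:
  "integrable M (\<xi> (Suc t))" "integrable M (\<lambda>\<omega>. (\<xi> (Suc t) \<omega>)\<^sup>2)"
  "expectation (\<xi> (Suc t)) = 0" "expectation (\<lambda>\<omega>. (\<xi> (Suc t) \<omega>)\<^sup>2) = 1"
proof -
  have d: "distr M borel (\<xi> (Suc t)) = distr M borel (\<xi> (Suc 0))"
    using noise_identical[of "Suc t"] by simp
  have int: "integrable M (\<lambda>\<omega>. f (\<xi> (Suc t) \<omega>)) \<longleftrightarrow> integrable M (\<lambda>\<omega>. f (\<xi> (Suc 0) \<omega>))"
    and ex: "expectation (\<lambda>\<omega>. f (\<xi> (Suc t) \<omega>)) = expectation (\<lambda>\<omega>. f (\<xi> (Suc 0) \<omega>))"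
    if "f \<in> borel_measurable borel" for f :: "real \<Rightarrow> real"
    using that d integrable_distr_eq[OF measurable_noise[of t] that] integral_distr[OF measurable_noise[of t] that]
      integrable_distr_eq[OF measurable_noise[of 0] that] integral_distr[OF measurable_noise[of 0] that]
    by simp_all
  show "integrable M (\<xi> (Suc t))" "integrable M (\<lambda>\<omega>. (\<xi> (Suc t) \<omega>)\<^sup>2)"
    "expectation (\<xi> (Suc t)) = 0" "expectation (\<lambda>\<omega>. (\<xi> (Suc t) \<omega>)\<^sup>2) = 1"
    using int[of "\<lambda>x. x"] int[of "\<lambda>x. x\<^sup>2"] ex[of "\<lambda>x. x"] ex[of "\<lambda>x. x\<^sup>2"]
      noise_integrable noise_standardized by simp_all
qed

end

section \<open>Concentration of the estimates\<close>

text \<open>A potential that decreases by at least \<open>1 / (max (x + 1) N)\<^sup>2\<close> from \<open>x\<close> to \<open>x + 1\<close>; it pays for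
  the conditional variances in the maximal inequality.\<close>

definition variance_budget :: "nat \<Rightarrow> real \<Rightarrow> real" where
  "variance_budget N x = (if x \<le> real N then 2 / real N - x / (real N)\<^sup>2 else 1 / x)"

text \<open>Up to \<open>N\<close> the budget is linear with slope \<open>-1 / N\<^sup>2\<close>, so
  equality holds; beyond, \<open>1 / k\<close> dominates by telescoping. Both branches have the
  value \<open>1 / N\<close> at \<open>N\<close>, and integer steps never jump over this
  point.\<close>

lemma variance_budget_step:
  assumes "N \<ge> 1" "k \<ge> 1"
  shows "variance_budget N (real k + 1) + 1 / (max (real k + 1) (real N))\<^sup>2 \<le> variance_budget N (real k)"
proof -
  consider "k + 1 \<le> N" | "k = N" | "k > N" by linarith
  then show ?thesis
  proof cases
    case 1
    then have "real k + 1 \<le> real N" by linarith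
    then show ?thesis using assms by (simp add: variance_budget_def max_def add_divide_distrib)
  next
    case 2
    have "1 / (real N + 1) + 1 / (real N + 1)\<^sup>2 \<le> 1 / real N"
      using assms by (simp add: divide_simps power2_eq_square) (simp add: algebra_simps)
    moreover have "2 / real N - real N / (real N)\<^sup>2 = 1 / real N"
      using assms by (simp add: power2_eq_square field_simps)
    ultimately show ?thesis using 2 by (simp add: variance_budget_def max_def)
  next
    case 3
    have "1 / (real k + 1) + 1 / (real k + 1)\<^sup>2 \<le> 1 / real k"
      using assms by (simp add: divide_simps power2_eq_square) (simp add: algebra_simps)
    then show ?thesis using 3 by (simp add: variance_budget_def max_def)
  qed
qed

lemma variance_budget_bounds:
  assumes "N \<ge> 1" "x \<ge> 0"
  shows "0 \<le> variance_budget N x" "variance_budget N x \<le> 2 / real N"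
proof -
  have "x / (real N)\<^sup>2 \<le> 2 / real N" if "x \<le> real N"
    using assms that by (simp add: divide_simps power2_eq_square)
  moreover have "1 / x \<le> 2 / real N" if "real N < x"
    using assms that by (simp add: divide_simps)
  ultimately show "0 \<le> variance_budget N x" "variance_budget N x \<le> 2 / real N"
    using assms by (auto simp: variance_budget_def)
qed

context thompson_run
begin

text \<open>From \<open>N\<close> effective observations on, the estimate is within \<open>D\<close>
  of the mean. For fewer observations this would fail with substantial probability, so the allowed
  deviation of the sum is held at \<open>D * N\<close>.\<close>

definition good :: "nat \<Rightarrow> real \<Rightarrow> nat \<Rightarrow> nat \<Rightarrow> 'w \<Rightarrow> bool" where
  "good a D N t \<omega> \<longleftrightarrow> (\<forall>s\<in>{..t}. \<bar>dev a s \<omega>\<bar> < D * max (n a s \<omega>) (real N))"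

definition potential :: "nat \<Rightarrow> nat \<Rightarrow> nat \<Rightarrow> 'w \<Rightarrow> real" where
  "potential a N t \<omega> = (dev a t \<omega> / max (n a t \<omega>) (real N))\<^sup>2 + \<sigma>\<^sup>2 * variance_budget N (n a t \<omega>)"

text \<open>Expanding the square leaves a term linear in the fresh noise and a multiple of its
  centred square. The remaining variance is paid by the budget, and the growth of the denominator
  only lowers the old square.\<close>

lemma potential_step:
  assumes "N \<ge> 1"
  shows "potential a N (Suc t) \<omega> \<le> potential a N t \<omega> +
    2 * \<sigma> * (of_bool (A (Suc t) \<omega> = a) * dev a t \<omega> / (max (n a t \<omega> + 1) (real N))\<^sup>2) * \<xi> (Suc t) \<omega> +
    \<sigma>\<^sup>2 * (of_bool (A (Suc t) \<omega> = a) / (max (n a t \<omega> + 1) (real N))\<^sup>2) * ((\<xi> (Suc t) \<omega>)\<^sup>2 - 1)"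
proof (cases "A (Suc t) \<omega> = a")
  case True
  define m m' where "m = max (n a t \<omega>) (real N)" and "m' = max (n a t \<omega> + 1) (real N)"
  have m: "0 < m" "m \<le> m'" using assms by (auto simp: m_def m'_def)
  obtain k where k: "n a t \<omega> = real (Suc k)" using nbar_eq_Suc by blast
  have "variance_budget N (n a t \<omega> + 1) + 1 / m'\<^sup>2 \<le> variance_budget N (n a t \<omega>)"
    unfolding k m'_def using assms by (rule variance_budget_step) simp
  then have "\<sigma>\<^sup>2 * (variance_budget N (n a t \<omega> + 1) + 1 / m'\<^sup>2) \<le> \<sigma>\<^sup>2 * variance_budget N (n a t \<omega>)"
    by (rule mult_left_mono) simp
  moreover have "(dev a t \<omega>)\<^sup>2 / m'\<^sup>2 \<le> (dev a t \<omega>)\<^sup>2 / m\<^sup>2"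
    using m by (intro divide_left_mono power_mono) auto
  moreover have "((dev a t \<omega> + \<sigma> * \<xi> (Suc t) \<omega>) / m')\<^sup>2 = (dev a t \<omega>)\<^sup>2 / m'\<^sup>2 +
      2 * \<sigma> * (dev a t \<omega> / m'\<^sup>2) * \<xi> (Suc t) \<omega> + \<sigma>\<^sup>2 * (1 / m'\<^sup>2) * (\<xi> (Suc t) \<omega>)\<^sup>2"
    using m by (simp add: field_simps power2_eq_square)
  ultimately show ?thesis
    using True by (simp add: potential_def dev_Suc flip: m_def m'_def)
      (simp add: power_divide algebra_simps diff_divide_distrib)
qed (simp add: potential_def dev_Suc)

lemma measurable_good_past [measurable]:
  "Measurable.pred (history X (past t)) (good a D N t)"
proof -
  have [measurable]: "n a s \<in> borel_measurable (history X (past t))"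
    "dev a s \<in> borel_measurable (history X (past t))" if "s \<in> {..t}" for s
    using that measurable_past(1)[of a s] measurable_dev_past[of a s]
    by (auto intro: measurable_history_mono[OF _ past_mono])
  show ?thesis unfolding good_def[abs_def] by measurable
qed

lemma measurable_good [measurable]: "Measurable.pred M (good a D N t)"
  by (rule measurable_history_imp_measurable[OF measurable_good_past])

text \<open>\<open>round t\<close> includes the choice of the arm but not the noise of that round.
  Boundedness of the weight gives integrability from the moments of the noise alone.\<close>

lemma expectation_times_noise:
  fixes W :: "'w \<Rightarrow> real" and f :: "real \<Rightarrow> real"
  assumes W: "W \<in> borel_measurable (history X (round t))" and bound: "\<And>\<omega>. \<bar>W \<omega>\<bar> \<le> C"
    and f: "f \<in> borel_measurable borel" "integrable M (\<lambda>\<omega>. f (\<xi> (Suc t) \<omega>))"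
    and zero: "expectation (\<lambda>\<omega>. f (\<xi> (Suc t) \<omega>)) = 0"
  shows "integrable M (\<lambda>\<omega>. W \<omega> * f (\<xi> (Suc t) \<omega>))" "expectation (\<lambda>\<omega>. W \<omega> * f (\<xi> (Suc t) \<omega>)) = 0"
proof -
  have WM [measurable]: "W \<in> borel_measurable M" using W by (rule measurable_history_imp_measurable)
  have "indep_var borel W borel (X (Inl (Suc t)))"
    by (rule indep_var_history[OF indep_X past_subset(3) _ _ W]) auto
  then have "indep_var borel ((\<lambda>x. x) \<circ> W) borel (f \<circ> \<xi> (Suc t))"
    by (intro indep_var_compose) (use f in \<open>auto simp: X_def\<close>)
  then have iv: "indep_var borel W borel (\<lambda>\<omega>. f (\<xi> (Suc t) \<omega>))" by (simp add: comp_def)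
  have int: "integrable M W" using bound by (intro integrable_const_bound[of _ C]) auto
  show "integrable M (\<lambda>\<omega>. W \<omega> * f (\<xi> (Suc t) \<omega>))"
    by (rule indep_var_integrable[OF iv int f(2)])
  show "expectation (\<lambda>\<omega>. W \<omega> * f (\<xi> (Suc t) \<omega>)) = 0"
    using indep_var_lebesgue_integral[OF iv int f(2)] zero by simp
qed

text \<open>A maximal inequality for the supermartingale \<open>potential a N\<close>, stopped at level \<open>D\<^sup>2\<close> as soon as
  \<open>good\<close> fails.\<close>

lemma prob_not_good:
  assumes N: "N \<ge> 1" and D: "D > 0"
  shows "prob {\<omega> \<in> space M. \<not> good a D N t \<omega>} \<le> ((\<mu> a)\<^sup>2 / (real N)\<^sup>2 + 2 * \<sigma>\<^sup>2 / real N) / D\<^sup>2"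
proof -
  \<comment> \<open>After a failure the value is frozen at \<open>D\<^sup>2\<close> instead of the
    potential at that time. This keeps \<open>Y\<close> bounded, whatever the size of the last
    noise.\<close>
  define Y where "Y t \<omega> = (if good a D N t \<omega> then potential a N t \<omega> else D\<^sup>2)" for t \<omega>
  define Q0 where "Q0 = (\<mu> a)\<^sup>2 / (real N)\<^sup>2 + 2 * \<sigma>\<^sup>2 / real N"
  define m where "m t \<omega> = max (n a t \<omega>) (real N)" for t \<omega>
  have m_pos: "m t \<omega> \<ge> 1" for t \<omega> using N by (simp add: m_def)
  have pot: "0 \<le> potential a N t \<omega>" for t \<omega>
    using variance_budget_bounds(1)[OF N] nbar_ge_1[of "\<lambda>s. A s \<omega>" a t] by (simp add: potential_def)
  have [measurable]: "potential a N t \<in> borel_measurable M" for t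
    unfolding potential_def[abs_def] variance_budget_def by measurable
  have [measurable]: "Y t \<in> borel_measurable M" for t unfolding Y_def by measurable
  have Y_bound: "\<bar>Y t \<omega>\<bar> \<le> D\<^sup>2 + \<sigma>\<^sup>2 * (2 / real N)" for t \<omega>
  proof (cases "good a D N t \<omega>")
    case True
    then have "\<bar>dev a t \<omega> / m t \<omega>\<bar> \<le> D"
      using m_pos[of t \<omega>] by (auto simp: good_def m_def[symmetric] divide_simps abs_mult intro: less_imp_le)
    then have "(dev a t \<omega> / m t \<omega>)\<^sup>2 \<le> D\<^sup>2" using D by (simp add: abs_le_square_iff[symmetric])
    moreover have "\<sigma>\<^sup>2 * variance_budget N (n a t \<omega>) \<le> \<sigma>\<^sup>2 * (2 / real N)"
      using nbar_ge_1[of "\<lambda>s. A s \<omega>" a t] by (intro mult_left_mono variance_budget_bounds(2)[OF N]) auto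
    ultimately show ?thesis using True pot[of t \<omega>] by (simp add: Y_def potential_def m_def)
  qed (simp add: Y_def)
  then have int_Y: "integrable M (Y t)" for t by (intro integrable_const_bound[of _ "D\<^sup>2 + \<sigma>\<^sup>2 * (2 / real N)"]) auto
  have "Y 0 \<omega> \<le> Q0" for \<omega>
  proof -
    have n0: "max (n a 0 \<omega>) (real N) = real N" using N by (simp add: max_def)
    have b: "potential a N 0 \<omega> \<le> Q0"
      using mult_left_mono[OF variance_budget_bounds(2)[OF N, of 1], of "\<sigma>\<^sup>2"]
      unfolding potential_def n0 Q0_def dev_0 by (simp add: power_divide mult.commute)
    show ?thesis
    proof (cases "good a D N 0 \<omega>")
      \<comment> \<open>Failure at time 0 means that the initial bias alone is too large, and then
        \<open>D\<^sup>2\<close> is below the bias term of \<open>Q0\<close>.\<close>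
      case False
      then have "D * real N \<le> \<bar>\<mu> a\<bar>" using n0 by (simp add: good_def dev_0)
      then have "D \<le> \<bar>\<mu> a\<bar> / real N" using N by (simp add: field_simps)
      then have "D\<^sup>2 \<le> (\<bar>\<mu> a\<bar> / real N)\<^sup>2" using D by (intro power_mono) auto
      then show ?thesis using False by (simp add: Y_def Q0_def power_divide) (simp add: add_increasing2)
    qed (use b in \<open>simp add: Y_def\<close>)
  qed
  then have base: "expectation (Y 0) \<le> Q0"
    using integral_mono[OF int_Y[of 0], of "\<lambda>_. Q0"] by (simp add: prob_space)
  have step: "expectation (Y (Suc t)) \<le> expectation (Y t)" for t
  proof -
    \<comment> \<open>The factor \<open>good\<close> switches the increment off after a failure;
      before it, the bound on \<open>dev\<close> makes the linear coefficient \<open>W\<close>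
      bounded by \<open>D\<close>.\<close>
    define V where "V \<omega> = of_bool (good a D N t \<omega>) * (of_bool (A (Suc t) \<omega> = a) / (max (n a t \<omega> + 1) (real N))\<^sup>2)" for \<omega>
    define W where "W \<omega> = V \<omega> * dev a t \<omega>" for \<omega>
    note [measurable] =
      measurable_good_past[where t = t and a = a and D = D and N = N, THEN measurable_history_mono, OF past_subset(1)]
      measurable_past(1)[of a t, THEN measurable_history_mono, OF past_subset(1)]
      measurable_dev_past[of a t, THEN measurable_history_mono, OF past_subset(1)]
      measurable_arm_history(2)[of t]
    have V_meas [measurable]: "V \<in> borel_measurable (history X (round t))"
      unfolding V_def by measurable
    have W_meas: "W \<in> borel_measurable (history X (round t))"
      unfolding W_def by measurable
    have V_bound: "\<bar>V \<omega>\<bar> \<le> 1 / (m t \<omega>)\<^sup>2" for \<omega>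
    proof -
      have "1 / (max (n a t \<omega> + 1) (real N))\<^sup>2 \<le> 1 / (m t \<omega>)\<^sup>2"
        using m_pos[of t \<omega>] by (intro divide_left_mono power_mono mult_pos_pos) (auto simp: m_def)
      then show ?thesis by (simp add: V_def)
    qed
    have "\<bar>V \<omega>\<bar> \<le> 1" for \<omega>
      using V_bound[of \<omega>] m_pos[of t \<omega>] one_le_power[OF m_pos[of t \<omega>], of 2]
      by (smt (verit) divide_le_eq_1 zero_le_power2)
    moreover have "\<bar>W \<omega>\<bar> \<le> D" for \<omega>
    proof (cases "good a D N t \<omega>")
      case True
      have "\<bar>W \<omega>\<bar> \<le> 1 / (m t \<omega>)\<^sup>2 * (D * m t \<omega>)"
        unfolding W_def abs_mult
        using True by (intro mult_mono V_bound) (auto simp: good_def m_def intro: less_imp_le)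
      also have "\<dots> = D / m t \<omega>" using m_pos[of t \<omega>] by (simp add: power2_eq_square)
      also have "\<dots> \<le> D" using m_pos[of t \<omega>] D by (simp add: divide_le_eq mult_le_cancel_left1)
      finally show ?thesis .
    qed (use D in \<open>simp add: W_def V_def\<close>)
    ultimately have
      W: "integrable M (\<lambda>\<omega>. W \<omega> * \<xi> (Suc t) \<omega>)" "expectation (\<lambda>\<omega>. W \<omega> * \<xi> (Suc t) \<omega>) = 0" and
      V: "integrable M (\<lambda>\<omega>. V \<omega> * ((\<xi> (Suc t) \<omega>)\<^sup>2 - 1))" "expectation (\<lambda>\<omega>. V \<omega> * ((\<xi> (Suc t) \<omega>)\<^sup>2 - 1)) = 0"
      using expectation_times_noise[OF W_meas, of D "\<lambda>x. x"]
        expectation_times_noise[OF V_meas, of 1 "\<lambda>x. x\<^sup>2 - 1"] noise_moments[of t]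
      by (simp_all add: prob_space)
    have "Y (Suc t) \<omega> \<le> Y t \<omega> + (2 * \<sigma>) * (W \<omega> * \<xi> (Suc t) \<omega>) + \<sigma>\<^sup>2 * (V \<omega> * ((\<xi> (Suc t) \<omega>)\<^sup>2 - 1))" for \<omega>
    proof (cases "good a D N t \<omega>")
      case True
      \<comment> \<open>When \<open>good\<close> fails for the first time, the squared term of the
        potential is at least \<open>D\<^sup>2\<close>, so freezing cannot raise the value.\<close>
      have "Y (Suc t) \<omega> \<le> potential a N (Suc t) \<omega>"
      proof (cases "good a D N (Suc t) \<omega>")
        case False
        with True have "D * m (Suc t) \<omega> \<le> \<bar>dev a (Suc t) \<omega>\<bar>"
          by (auto simp: good_def m_def atMost_Suc not_less simp del: nbar.simps)
        then have "D \<le> \<bar>dev a (Suc t) \<omega> / m (Suc t) \<omega>\<bar>"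
          using m_pos[of "Suc t" \<omega>] by (simp add: field_simps del: nbar.simps)
        then have "D\<^sup>2 \<le> (dev a (Suc t) \<omega> / m (Suc t) \<omega>)\<^sup>2" using D by (metis abs_le_square_iff abs_of_pos)
        then show ?thesis
          using False nbar_ge_1[of "\<lambda>s. A s \<omega>" a "Suc t"]
            variance_budget_bounds(1)[OF N, of "n a (Suc t) \<omega>"]
          by (simp add: Y_def potential_def m_def add_increasing2 del: nbar.simps)
      qed (simp add: Y_def)
      also note potential_step[OF N]
      finally show ?thesis using True by (simp add: Y_def W_def V_def mult.assoc)
    next
      case False
      then have "\<not> good a D N (Suc t) \<omega>" by (auto simp: good_def)
      then show ?thesis using False by (simp add: Y_def W_def V_def)
    qed
    then have "expectation (Y (Suc t)) \<le>
        expectation (\<lambda>\<omega>. Y t \<omega> + (2 * \<sigma>) * (W \<omega> * \<xi> (Suc t) \<omega>) + \<sigma>\<^sup>2 * (V \<omega> * ((\<xi> (Suc t) \<omega>)\<^sup>2 - 1)))"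
      by (intro integral_mono int_Y Bochner_Integration.integrable_add integrable_mult_right W V)
    also have "\<dots> = expectation (Y t)" using W V int_Y[of t] by simp
    finally show ?thesis .
  qed
  have "expectation (Y t) \<le> Q0" by (induction t) (use base step order_trans in blast)+
  moreover have "D\<^sup>2 * prob {\<omega> \<in> space M. \<not> good a D N t \<omega>} \<le> expectation (Y t)"
  proof -
    have "expectation (\<lambda>\<omega>. D\<^sup>2 * indicator {\<omega> \<in> space M. \<not> good a D N t \<omega>} \<omega>) \<le> expectation (Y t)"
    proof (rule integral_mono[OF _ int_Y])
      show "integrable M (\<lambda>\<omega>. D\<^sup>2 * indicator {\<omega> \<in> space M. \<not> good a D N t \<omega>} \<omega>)"
        by (intro integrable_const_bound[of _ "D\<^sup>2"]) (auto simp: indicator_def)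
    qed (use pot in \<open>auto simp: Y_def indicator_def\<close>)
    then show ?thesis by simp
  qed
  ultimately have "D\<^sup>2 * prob {\<omega> \<in> space M. \<not> good a D N t \<omega>} \<le> Q0" by linarith
  then show ?thesis using D by (simp add: Q0_def[symmetric] pos_le_divide_eq mult.commute)
qed

end

section \<open>Shortfalls and forced pulls\<close>

text \<open>The successive pulls of \<open>a\<close> find \<open>nbar\<close> at 1, 2, 3, ..., each
  value once. A sum along a random trajectory thus becomes a partial sum of a fixed series, of which
  only the length is random.\<close>

lemma sum_visits:
  fixes f :: "real \<Rightarrow> real"
  obtains j where "nbar A a T = real (Suc j)"
    and "(\<Sum>t<T. f (nbar A a t) * of_bool (A (Suc t) = a)) = (\<Sum>k<j. f (real (Suc k)))"
proof -
  have "\<exists>j. nbar A a T = real (Suc j) \<and>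
      (\<Sum>t<T. f (nbar A a t) * of_bool (A (Suc t) = a)) = (\<Sum>k<j. f (real (Suc k)))"
  proof (induction T)
    case (Suc T)
    then obtain j where "nbar A a T = real (Suc j)"
      "(\<Sum>t<T. f (nbar A a t) * of_bool (A (Suc t) = a)) = (\<Sum>k<j. f (real (Suc k)))" by blast
    then show ?case
      by (cases "A (Suc T) = a") (auto intro!: exI[of _ j] exI[of _ "Suc j"])
  qed (auto intro!: exI[of _ 0])
  then show ?thesis using that by blast
qed

text \<open>The sample quantile that lifts a perturbed mean to the threshold \<open>d\<close> above the true mean, when the
  effective sample size is \<open>x\<close> and the estimate is as low as the good event permits.\<close>

definition level :: "real \<Rightarrow> real \<Rightarrow> nat \<Rightarrow> real \<Rightarrow> real \<Rightarrow> real" where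
  "level \<sigma> D N d x = (d + D * max x (real N) / x) * sqrt x / \<sigma>"

context sampling_distribution
begin

definition odds :: "real \<Rightarrow> real" where
  "odds x = cdf \<nu> x / tail \<nu> x"

lemma odds_nonneg: "0 \<le> odds x"
  using cdf_bounds(1)[of x] tail_bounds(1)[of x] by (simp add: odds_def)

lemma measurable_tail [measurable]: "tail \<nu> \<in> borel_measurable borel"
  by (rule borel_measurable_continuous_onI) (rule continuous_on_tail)

lemma measurable_odds [measurable]: "odds \<in> borel_measurable borel"
proof -
  have [measurable]: "cdf \<nu> \<in> borel_measurable borel"
    by (rule borel_measurable_continuous_onI) (rule continuous_on_cdf)
  show ?thesis unfolding odds_def[abs_def] by measurable
qed

text \<open>The odds increase with the threshold, so a random threshold may be replaced by its worst
  value.\<close>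

lemma cdf_le_odds_times_tail:
  assumes "u \<le> x"
  shows "cdf \<nu> u \<le> odds x * tail \<nu> u"
proof -
  have "cdf \<nu> u \<le> odds x * tail \<nu> x"
    using cdf_nondecreasing[OF assms] tail_bounds(1)[of x] by (simp add: odds_def)
  also have "\<dots> \<le> odds x * tail \<nu> u"
    by (intro mult_left_mono tail_antimono assms odds_nonneg)
  finally show ?thesis .
qed

lemma emeasure_greaterThan: "emeasure \<nu> {u<..} = ennreal (tail \<nu> u)"
  by (simp add: emeasure_eq_measure measure_greaterThan)

lemma emeasure_atMost: "emeasure \<nu> {..u} = ennreal (cdf \<nu> u)"
  by (simp add: emeasure_eq_measure cdf_def)

end

context thompson_run
begin

text \<open>Concentration of arm \<open>b\<close> belongs to the event so that the sample threshold
  for \<open>b\<close> is bounded by \<open>level\<close>, a function of the pulls of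
  \<open>b\<close> alone.\<close>

definition shortfall :: "nat \<Rightarrow> real \<Rightarrow> nat \<Rightarrow> real \<Rightarrow> nat \<Rightarrow> 'w set" where
  "shortfall b D N y t =
     {\<omega> \<in> space M. \<bar>dev b t \<omega>\<bar> < D * max (n b t \<omega>) (real N) \<and> (\<forall>a\<in>arms. index a t \<omega> \<le> y)}"

lemma sets_shortfall [measurable]: "shortfall b D N y t \<in> events"
  unfolding shortfall_def by measurable

text \<open>Given the history and the samples of all other arms, raising the sample of arm \<open>b\<close> above the
  threshold \<open>y\<close> makes arm \<open>b\<close> the winner. Hence the conditional probability of a shortfall is at
  most the odds times the conditional probability of pulling \<open>b\<close>.\<close>

lemma emeasure_shortfall_le:
  assumes b: "b \<in> arms"
  shows "emeasure M (shortfall b D N y t) \<le>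
    (\<integral>\<^sup>+\<omega>. ennreal (law.odds (level \<sigma> D N (y - \<mu> b) (n b t \<omega>)) * of_bool (A (Suc t) \<omega> = b)) \<partial>M)"
proof -
  let ?i = "Inr (b, Suc t)"
  let ?I = "round t - {?i}"
  \<comment> \<open>The part of the shortfall that does not involve the fresh sample of
    \<open>b\<close>.\<close>
  define others where "others \<omega> \<longleftrightarrow>
    \<bar>dev b t \<omega>\<bar> < D * max (n b t \<omega>) (real N) \<and> (\<forall>a\<in>arms - {b}. index a t \<omega> \<le> y)" for \<omega>
  \<comment> \<open>The sample of \<open>b\<close> at which its perturbed mean equals
    \<open>y\<close>.\<close>
  define U where "U \<omega> = (y - estimate b t \<omega>) * sqrt (n b t \<omega>) / \<sigma>" for \<omega>
  define w where "w \<omega> = law.odds (level \<sigma> D N (y - \<mu> b) (n b t \<omega>))" for \<omega>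
  have i: "?I \<subseteq> sources" "?i \<in> sources" "?i \<notin> ?I" using b past_subset(3) by auto
  have sub: "past t \<subseteq> ?I" by (auto simp: past_def round_def)
  note distr = distr_X_Z[OF i(2)]
  have X_eq: "X ?i = Z b (Suc t)" by (simp add: X_def)
  have [measurable]: "index a t \<in> borel_measurable (history X ?I)" if "a \<in> arms - {b}" for a
  proof -
    have [measurable]: "Z a (Suc t) \<in> borel_measurable (history X ?I)"
      using that i(1) by (intro measurable_Z_history) auto
    note [measurable] = measurable_past[where a = a, THEN measurable_history_mono, OF sub]
    show ?thesis unfolding index_def[abs_def] by measurable
  qed
  note [measurable] = measurable_past[where a = b, THEN measurable_history_mono, OF sub]
    measurable_dev_past[where a = b, THEN measurable_history_mono, OF sub]
  have [measurable]: "Measurable.pred (history X ?I) others"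
    unfolding others_def[abs_def] by measurable
  have [measurable]: "U \<in> borel_measurable (history X ?I)" "w \<in> borel_measurable (history X ?I)"
    unfolding U_def w_def level_def by measurable
  have w_nonneg: "0 \<le> w \<omega>" for \<omega> by (simp add: w_def law.odds_nonneg)
  have index_le: "index b t \<omega> \<le> y \<longleftrightarrow> Z b (Suc t) \<omega> \<le> U \<omega>" for \<omega>
  proof -
    have "sqrt (n b t \<omega>) > 0" using nbar_ge_1[of "\<lambda>s. A s \<omega>" b t] by simp
    then show ?thesis using sigma_pos by (simp add: index_def U_def field_simps)
  qed
  have le: "cdf \<nu> (U \<omega>) \<le> w \<omega> * tail \<nu> (U \<omega>)" if "others \<omega>" for \<omega>
    unfolding w_def
  proof (rule law.cdf_le_odds_times_tail)
    have "- (D * max (n b t \<omega>) (real N)) / n b t \<omega> \<le> dev b t \<omega> / n b t \<omega>"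
      using that nbar_ge_1[of "\<lambda>s. A s \<omega>" b t] by (intro divide_right_mono) (auto simp: others_def)
    then have "y - estimate b t \<omega> \<le> y - \<mu> b + D * max (n b t \<omega>) (real N) / n b t \<omega>"
      by (simp add: estimate_eq)
    then show "U \<omega> \<le> level \<sigma> D N (y - \<mu> b) (n b t \<omega>)"
      unfolding U_def level_def
      using sigma_pos nbar_ge_1[of "\<lambda>s. A s \<omega>" b t]
      by (intro divide_right_mono mult_right_mono) auto
  qed
  have others_f: "(\<lambda>\<omega>. (of_bool (others \<omega>), U \<omega>)) \<in> measurable (history X ?I) (borel \<Otimes>\<^sub>M borel)"
    and wf: "(\<lambda>\<omega>. (of_bool (others \<omega>) * w \<omega>, U \<omega>)) \<in> measurable (history X ?I) (borel \<Otimes>\<^sub>M borel)"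
    by measurable
  have "emeasure M (shortfall b D N y t) = (\<integral>\<^sup>+\<omega>. indicator (shortfall b D N y t) \<omega> \<partial>M)"
    by simp
  also have "\<dots> = (\<integral>\<^sup>+\<omega>. (\<lambda>(v, u) z. ennreal v * indicator {z. z \<le> u} z) (of_bool (others \<omega>), U \<omega>) (X ?i \<omega>) \<partial>M)"
    by (rule nn_integral_cong)
      (use b in \<open>auto simp: shortfall_def others_def indicator_def X_eq index_le[symmetric]\<close>)
  also have "\<dots> = (\<integral>\<^sup>+\<omega>. (\<integral>\<^sup>+z. (\<lambda>(v, u) z. ennreal v * indicator {z. z \<le> u} z) (of_bool (others \<omega>), U \<omega>) z
      \<partial>distr M borel (X ?i)) \<partial>M)"
    by (rule nn_integral_history[OF indep_X i others_f]) (simp add: split_beta', measurable)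
  also have "\<dots> = (\<integral>\<^sup>+\<omega>. ennreal (of_bool (others \<omega>)) * ennreal (cdf \<nu> (U \<omega>)) \<partial>M)"
    by (rule nn_integral_cong)
      (simp add: distr nn_integral_cmult law.emeasure_atMost flip: atMost_def)
  \<comment> \<open>With the sample integrated out, \<open>cdf\<close> is traded for odds times
    \<open>tail\<close>; the sample is then put back, now on the other side of
    \<open>U\<close>.\<close>
  also have "\<dots> \<le> (\<integral>\<^sup>+\<omega>. ennreal (of_bool (others \<omega>) * w \<omega>) * ennreal (tail \<nu> (U \<omega>)) \<partial>M)"
    by (rule nn_integral_mono)
      (use le w_nonneg in \<open>auto simp: less_imp_le[OF law.tail_bounds(1)] simp flip: ennreal_mult intro!: ennreal_leI\<close>)
  also have "\<dots> = (\<integral>\<^sup>+\<omega>. (\<integral>\<^sup>+z. (\<lambda>(v, u) z. ennreal v * indicator {z. u < z} z) (of_bool (others \<omega>) * w \<omega>, U \<omega>) z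
      \<partial>distr M borel (X ?i)) \<partial>M)"
    by (rule nn_integral_cong)
      (simp add: distr nn_integral_cmult law.emeasure_greaterThan flip: greaterThan_def)
  also have "\<dots> = (\<integral>\<^sup>+\<omega>. (\<lambda>(v, u) z. ennreal v * indicator {z. u < z} z) (of_bool (others \<omega>) * w \<omega>, U \<omega>) (X ?i \<omega>) \<partial>M)"
    by (rule nn_integral_history[OF indep_X i wf, symmetric]) (simp add: split_beta', measurable)
  also have "\<dots> \<le> (\<integral>\<^sup>+\<omega>. ennreal (w \<omega> * of_bool (A (Suc t) \<omega> = b)) \<partial>M)"
  proof (rule nn_integral_mono)
    fix \<omega> assume \<omega>: "\<omega> \<in> space M"
    show "(\<lambda>(v, u) z. ennreal v * indicator {z. u < z} z) (of_bool (others \<omega>) * w \<omega>, U \<omega>) (X ?i \<omega>) \<le>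
        ennreal (w \<omega> * of_bool (A (Suc t) \<omega> = b))"
    proof (cases "others \<omega> \<and> U \<omega> < Z b (Suc t) \<omega>")
      case True
      \<comment> \<open>Arm \<open>b\<close> is strictly above \<open>y\<close> and all other arms
        are at most \<open>y\<close>, so no tie can arise.\<close>
      then have "y < index (A (Suc t) \<omega>) t \<omega>"
        using index_le[of \<omega>] index_le_index_arm[OF \<omega> b, of t] by linarith
      then have "A (Suc t) \<omega> = b"
        using True arm_in_arms[OF \<omega>, of t] by (force simp: others_def)
      then show ?thesis using True by (simp add: X_eq)
    qed (auto simp: X_eq)
  qed
  finally show ?thesis by (simp add: w_def)
qed

text \<open>Only rounds that pull \<open>b\<close> contribute to the bound of
  \<open>emeasure_shortfall_le\<close>, so \<open>sum_visits\<close> bounds the total on every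
  trajectory by the full series, uniformly in \<open>T\<close>.\<close>

lemma sum_prob_shortfall_le:
  assumes b: "b \<in> arms" and sm: "summable (\<lambda>k. law.odds (level \<sigma> D N (y - \<mu> b) (real (Suc k))))"
  shows "(\<Sum>t<T. prob (shortfall b D N y t)) \<le> (\<Sum>k. law.odds (level \<sigma> D N (y - \<mu> b) (real (Suc k))))"
    (is "?L \<le> ?S")
proof -
  let ?w = "\<lambda>x. law.odds (level \<sigma> D N (y - \<mu> b) x)"
  have [measurable]: "?w \<in> borel_measurable borel" unfolding level_def by measurable
  have "ennreal ?L = (\<Sum>t<T. emeasure M (shortfall b D N y t))"
    by (simp add: emeasure_eq_measure sum_ennreal)
  also have "\<dots> \<le> (\<Sum>t<T. \<integral>\<^sup>+\<omega>. ennreal (?w (n b t \<omega>) * of_bool (A (Suc t) \<omega> = b)) \<partial>M)"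
    by (intro sum_mono emeasure_shortfall_le b)
  also have "\<dots> = (\<integral>\<^sup>+\<omega>. (\<Sum>t<T. ennreal (?w (n b t \<omega>) * of_bool (A (Suc t) \<omega> = b))) \<partial>M)"
    by (intro nn_integral_sum[symmetric]) measurable
  also have "\<dots> \<le> (\<integral>\<^sup>+\<omega>. ennreal ?S \<partial>M)"
  proof (rule nn_integral_mono)
    fix \<omega>
    obtain j where j: "(\<Sum>t<T. ?w (n b t \<omega>) * of_bool (A (Suc t) \<omega> = b)) = (\<Sum>k<j. ?w (real (Suc k)))"
      using sum_visits[where A = "\<lambda>s. A s \<omega>" and f = ?w] by blast
    have "(\<Sum>t<T. ennreal (?w (n b t \<omega>) * of_bool (A (Suc t) \<omega> = b))) = ennreal (\<Sum>k<j. ?w (real (Suc k)))"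
      unfolding j[symmetric] by (rule sum_ennreal) (simp add: law.odds_nonneg)
    also have "\<dots> \<le> ennreal ?S"
      by (intro ennreal_leI sum_le_suminf sm) (auto simp: law.odds_nonneg)
    finally show "(\<Sum>t<T. ennreal (?w (n b t \<omega>) * of_bool (A (Suc t) \<omega> = b))) \<le> ennreal ?S" .
  qed
  also have "\<dots> = ennreal ?S" by (simp add: emeasure_space_1)
  finally show ?thesis
    using suminf_nonneg[OF sm] law.odds_nonneg by (simp add: ennreal_le_iff)
qed

lemma integrable_indicator: "E \<in> events \<Longrightarrow> integrable M (indicat_real E)"
  by (intro integrable_real_indicator) (auto simp: less_top[symmetric])

lemma prob_many_shortfalls:
  assumes b: "b \<in> arms" and sm: "summable (\<lambda>k. law.odds (level \<sigma> D N (y - \<mu> b) (real (Suc k))))" and "c > 0"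
  shows "prob {\<omega> \<in> space M. c \<le> (\<Sum>t<T. of_bool (\<omega> \<in> shortfall b D N y t))} \<le>
    (\<Sum>k. law.odds (level \<sigma> D N (y - \<mu> b) (real (Suc k)))) / c"
proof -
  let ?f = "\<lambda>\<omega>. \<Sum>t<T. indicator (shortfall b D N y t) \<omega> :: real"
  have "prob {\<omega> \<in> space M. c \<le> ?f \<omega>} \<le> expectation ?f / c"
    by (rule integral_Markov_inequality_measure[where A = "space M"])
      (use assms(3) in \<open>auto intro!: sum_nonneg Bochner_Integration.integrable_sum integrable_indicator\<close>)
  also have "expectation ?f = (\<Sum>t<T. prob (shortfall b D N y t))"
    by (subst Bochner_Integration.integral_sum) (auto intro: integrable_indicator)
  also have "(\<Sum>t<T. prob (shortfall b D N y t)) / c \<le> (\<Sum>k. law.odds (level \<sigma> D N (y - \<mu> b) (real (Suc k)))) / c"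
    by (intro divide_right_mono sum_prob_shortfall_le b sm) (use assms(3) in auto)
  finally show ?thesis by (simp add: indicator_def)
qed

text \<open>With \<open>v\<close> and \<open>x\<close> large enough, arm \<open>a\<close> is pulled in round \<open>Suc t\<close> whenever the estimates are
  concentrated and \<open>a\<close> has had few pulls so far.\<close>

definition forced :: "nat \<Rightarrow> real \<Rightarrow> real \<Rightarrow> nat \<Rightarrow> 'w set" where
  "forced a v x t = {\<omega> \<in> space M. v < Z a (Suc t) \<omega> \<and> (\<forall>b\<in>arms - {a}. Z b (Suc t) \<omega> \<le> - x)}"

lemma sets_forced [measurable]: "a \<in> arms \<Longrightarrow> forced a v x t \<in> events"
  unfolding forced_def by measurable

text \<open>Different rounds use disjoint sets of samples. One and two rounds give the first and
  second moments of the number of forced pulls.\<close>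

lemma prob_forced_Inter:
  assumes a: "a \<in> arms" and S: "finite S" "S \<noteq> {}"
  shows "prob (\<Inter>t\<in>S. forced a v x t) = (tail \<nu> v * cdf \<nu> (- x) ^ (K - 1)) ^ card S"
proof -
  define B where "B b = (if b = a then {v<..} else {..- x})" for b
  define J :: "(nat + nat \<times> nat) set" where "J = (\<lambda>(t, b). Inr (b, Suc t)) ` (S \<times> arms)"
  \<comment> \<open>The value 0 on noise indices is a dummy; \<open>J\<close> contains none.\<close>
  let ?B = "\<lambda>i. B (case i of Inl t \<Rightarrow> 0 | Inr (b, t) \<Rightarrow> b)"
  have J: "J \<noteq> {}" "finite J" "J \<subseteq> sources" using a S by (auto simp: J_def)
  have inj: "inj_on (\<lambda>(t, b). Inr (b, Suc t)) (S \<times> arms)" by (auto simp: inj_on_def)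
  have B: "prob (Z b (Suc t) -` B b \<inter> space M) = (if b = a then tail \<nu> v else cdf \<nu> (- x))"
    if "b \<in> arms" for b t
  proof -
    have "prob (Z b (Suc t) -` B b \<inter> space M) = measure (distr M borel (Z b (Suc t))) (B b)"
      using that by (subst measure_distr) (auto simp: B_def)
    then show ?thesis using sampling_law[of b "Suc t"] that
      by (simp add: B_def law.measure_greaterThan cdf_def)
  qed
  have "(\<Inter>t\<in>S. forced a v x t) = (\<Inter>i\<in>J. X i -` ?B i \<inter> space M)"
  proof -
    have "forced a v x t = {\<omega> \<in> space M. \<forall>b\<in>arms. Z b (Suc t) \<omega> \<in> B b}" for t
      using a unfolding forced_def B_def by (auto split: if_split_asm)
    then show ?thesis using a S by (auto simp: J_def X_def)
  qed
  also have "prob \<dots> = (\<Prod>i\<in>J. prob (X i -` ?B i \<inter> space M))"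
    by (rule indep_varsD[OF indep_X J]) (auto simp: B_def)
  also have "\<dots> = (\<Prod>(t, b)\<in>S \<times> arms. prob (Z b (Suc t) -` B b \<inter> space M))"
    unfolding J_def by (subst prod.reindex[OF inj]) (simp add: X_def split_beta)
  also have "\<dots> = (\<Prod>t\<in>S. \<Prod>b\<in>arms. prob (Z b (Suc t) -` B b \<inter> space M))"
    by (rule prod.cartesian_product[symmetric])
  also have "\<dots> = (\<Prod>t\<in>S. \<Prod>b\<in>arms. if b = a then tail \<nu> v else cdf \<nu> (- x))"
    by (intro prod.cong refl B)
  also have "(\<Prod>b\<in>arms. if b = a then tail \<nu> v else cdf \<nu> (- x)) =
      tail \<nu> v * (\<Prod>b\<in>arms - {a}. cdf \<nu> (- x))"
    using a by (subst prod.remove[of arms a]) (auto intro!: arg_cong2[where f = "(*)"] prod.cong)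
  also have "(\<Prod>b\<in>arms - {a}. cdf \<nu> (- x)) = cdf \<nu> (- x) ^ (K - 1)"
    using a by simp
  finally show ?thesis by simp
qed

text \<open>Chebyshev at half the mean: for independent events of probability \<open>r\<close> the
  variance of the count is at most its mean \<open>T * r\<close>, whence the 4.\<close>

lemma prob_few_forced:
  assumes a: "a \<in> arms" and T: "T \<ge> 1" and r: "r = tail \<nu> v * cdf \<nu> (- x) ^ (K - 1)"
  shows "prob {\<omega> \<in> space M. (\<Sum>t<T. of_bool (\<omega> \<in> forced a v x t)) \<le> real T * r / 2} \<le> 4 / (real T * r)"
proof -
  let ?F = "\<lambda>t. forced a v x t"
  let ?f = "\<lambda>\<omega>. \<Sum>t<T. indicator (?F t) \<omega> :: real"
  note [measurable] = sets_forced[OF a]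
  have r_pos: "r > 0" using law.tail_bounds(1) law.cdf_bounds(1) by (simp add: r)
  have p1: "prob (?F t) = r" for t
    using prob_forced_Inter[OF a, of "{t}" v x] by (simp add: r)
  have p2: "prob (?F s \<inter> ?F t) = r\<^sup>2 + of_bool (s = t) * (r - r\<^sup>2)" for s t
    using prob_forced_Inter[OF a, of "{s, t}" v x] p1 by (cases "s = t") (auto simp: r power2_eq_square)
  have ex: "expectation ?f = real T * r"
    by (subst Bochner_Integration.integral_sum) (auto simp: p1 intro: integrable_indicator)
  have sq: "(?f \<omega>)\<^sup>2 = (\<Sum>s<T. \<Sum>t<T. indicator (?F s \<inter> ?F t) \<omega>)" for \<omega>
    by (simp add: power2_eq_square sum_product indicator_inter_arith)
  have "expectation (\<lambda>\<omega>. (?f \<omega>)\<^sup>2) = (\<Sum>s<T. \<Sum>t<T. prob (?F s \<inter> ?F t))"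
    unfolding sq using integrable_indicator
    by (simp add: Bochner_Integration.integral_sum Bochner_Integration.integrable_sum sets.Int)
  also have "\<dots> = (\<Sum>s<T. real T * r\<^sup>2 + (r - r\<^sup>2))"
    by (intro sum.cong refl) (simp add: p2 sum.distrib of_bool_def if_distrib[of "\<lambda>z. z * _"] cong: if_cong)
  finally have ex2: "expectation (\<lambda>\<omega>. (?f \<omega>)\<^sup>2) = (real T * r)\<^sup>2 + real T * (r - r\<^sup>2)"
    by (simp add: power2_eq_square algebra_simps)
  have int2: "integrable M (\<lambda>\<omega>. (?f \<omega>)\<^sup>2)" unfolding sq
    by (intro Bochner_Integration.integrable_sum integrable_indicator) auto
  have "variance ?f \<le> real T * r"
    using int2 by (subst variance_eq)
      (auto simp: ex ex2 right_diff_distrib intro!: Bochner_Integration.integrable_sum integrable_indicator)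
  moreover have "prob {\<omega> \<in> space M. real T * r / 2 \<le> \<bar>?f \<omega> - expectation ?f\<bar>} \<le> variance ?f / (real T * r / 2)\<^sup>2"
    by (rule Chebyshev_inequality) (use int2 T r_pos in auto)
  ultimately have "prob {\<omega> \<in> space M. real T * r / 2 \<le> \<bar>?f \<omega> - expectation ?f\<bar>} \<le> real T * r / (real T * r / 2)\<^sup>2"
    by (meson divide_right_mono order_trans zero_le_power2)
  moreover have "prob {\<omega> \<in> space M. ?f \<omega> \<le> real T * r / 2} \<le>
      prob {\<omega> \<in> space M. real T * r / 2 \<le> \<bar>?f \<omega> - expectation ?f\<bar>}"
    unfolding ex
  proof (rule finite_measure_mono)
    have "c / 2 \<le> \<bar>f - c\<bar>" if "f \<le> c / 2" for f c :: real
      using that by linarith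
    then show "{\<omega> \<in> space M. ?f \<omega> \<le> real T * r / 2} \<subseteq>
        {\<omega> \<in> space M. real T * r / 2 \<le> \<bar>?f \<omega> - real T * r\<bar>}" by blast
  qed measurable
  ultimately show ?thesis
    using T r_pos by (simp add: power2_eq_square indicator_def of_bool_def)
qed

end

section \<open>Bounds for the pull counts\<close>

lemma sum_early_visits:
  assumes "m \<ge> 0"
  shows "(\<Sum>t<T. of_bool (A (Suc t) = a \<and> nbar A a t < m)) \<le> m"
proof -
  \<comment> \<open>Strengthened for the induction: a counted pull raises \<open>nbar - 1\<close> to
    the old \<open>nbar\<close>, which is below \<open>m\<close>.\<close>
  have "(\<Sum>t<T. of_bool (A (Suc t) = a \<and> nbar A a t < m)) \<le> min m (nbar A a T - 1)"
    using assms by (induction T) auto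
  then show ?thesis by simp
qed

lemma pulls_eq_sum: "pulls A a T = (\<Sum>t<T. of_bool (A (Suc t) = a))"
  by (simp add: pulls_def sum.atLeast1_atMost_eq)

text \<open>From \<open>N\<close> on the maximum in \<open>level\<close> is inactive, and the level
  is a negative multiple of \<open>sqrt x\<close> because \<open>d + D < 0\<close>; earlier terms do
  not affect convergence.\<close>

lemma (in sampling_distribution) summable_odds_level:
  assumes "\<sigma> > 0" "d + D < 0"
  shows "summable (\<lambda>k. odds (level \<sigma> D N d (real (Suc k))))"
proof -
  let ?c = "- (d + D) / \<sigma>"
  have "\<forall>\<^sub>F k in sequentially.
      odds (level \<sigma> D N d (real (Suc k))) = odds (- (?c * sqrt (real (Suc k))))"
    using eventually_ge_at_top[of N]
  proof eventually_elim
    case (elim k)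
    have "max (real (Suc k)) (real N) = real (Suc k)" using elim by (simp add: max_def)
    then have "D * max (real (Suc k)) (real N) / real (Suc k) = D"
      by (simp only: nonzero_mult_div_cancel_right of_nat_eq_0_iff nat.distinct not_False_eq_True)
    then have "level \<sigma> D N d (real (Suc k)) = (d + D) * sqrt (real (Suc k)) / \<sigma>"
      by (simp only: level_def)
    then have "level \<sigma> D N d (real (Suc k)) = - (?c * sqrt (real (Suc k)))"
      by (metis minus_divide_left minus_minus mult_minus_left times_divide_eq_left)
    then show ?case by simp
  qed
  moreover have "summable (\<lambda>k. odds (- (?c * sqrt (real (Suc k)))))"
    using summable_cdf_ratio[of ?c] assms unfolding odds_def
    by (subst summable_Suc_iff[where f = "\<lambda>k. cdf \<nu> (- (?c * sqrt (real k))) / tail \<nu> (- (?c * sqrt (real k)))"])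
      (simp add: divide_neg_pos)
  ultimately show ?thesis by (simp only: summable_cong)
qed

context thompson_run
begin

text \<open>Each pull of \<open>a\<close> happens either while \<open>nbar\<close> is below
  \<open>m\<close> or in a shortfall: afterwards the estimate is at most \<open>\<mu> a + D\<close>
  and the sample at most \<open>v\<close>, so even the winning perturbed mean is at most
  \<open>y\<close>.\<close>

lemma pulls_le:
  assumes \<omega>: "\<omega> \<in> space M" and D: "D > 0"
    and good: "good a D N T \<omega>" "good b D N T \<omega>"
    and m: "real N \<le> m" and d: "0 \<le> y - \<mu> a - D" and v: "v \<le> (y - \<mu> a - D) * sqrt m / \<sigma>"
    and Z: "\<And>t. t < T \<Longrightarrow> Z a (Suc t) \<omega> \<le> v"
  shows "pulls (\<lambda>s. A s \<omega>) a T \<le> m + (\<Sum>t<T. of_bool (\<omega> \<in> shortfall b D N y t))"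
proof -
  have "of_bool (A (Suc t) \<omega> = a) \<le> of_bool (A (Suc t) \<omega> = a \<and> n a t \<omega> < m) +
      (of_bool (\<omega> \<in> shortfall b D N y t) :: real)" if t: "t < T" for t
  proof (cases "A (Suc t) \<omega> = a \<and> m \<le> n a t \<omega>")
    case True
    let ?n = "n a t \<omega>"
    have n: "?n \<ge> 1" by (rule nbar_ge_1)
    have "max ?n (real N) = ?n" using True m by simp
    then have "\<bar>dev a t \<omega>\<bar> < D * ?n" using good(1) t by (metis atMost_iff good_def less_imp_le)
    then have "dev a t \<omega> / ?n \<le> D" using n by (simp add: divide_le_eq)
    then have est: "estimate a t \<omega> \<le> \<mu> a + D" by (simp add: estimate_eq)
    have "Z a (Suc t) \<omega> \<le> (y - \<mu> a - D) * sqrt m / \<sigma>" using Z[OF t] v by simp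
    also have "\<dots> \<le> (y - \<mu> a - D) * sqrt ?n / \<sigma>"
      using d True sigma_pos by (intro divide_right_mono mult_left_mono) auto
    finally have "\<sigma> / sqrt ?n * Z a (Suc t) \<omega> \<le> \<sigma> / sqrt ?n * ((y - \<mu> a - D) * sqrt ?n / \<sigma>)"
      using sigma_pos n by (intro mult_left_mono) auto
    also have "\<dots> = y - \<mu> a - D" using sigma_pos n by simp
    finally have "index a t \<omega> \<le> y" using est by (simp add: index_def)
    then have "\<forall>c\<in>arms. index c t \<omega> \<le> y"
      using index_le_index_arm[OF \<omega>, of _ t] True order_trans by blast
    then have "\<omega> \<in> shortfall b D N y t"
      using \<omega> good(2) t by (auto simp: shortfall_def good_def)
    then show ?thesis by simp
  qed auto
  then have "pulls (\<lambda>s. A s \<omega>) a T \<le>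
      (\<Sum>t<T. of_bool (A (Suc t) \<omega> = a \<and> n a t \<omega> < m) + of_bool (\<omega> \<in> shortfall b D N y t))"
    unfolding pulls_eq_sum by (intro sum_mono) simp
  also have "\<dots> \<le> m + (\<Sum>t<T. of_bool (\<omega> \<in> shortfall b D N y t))"
    using sum_early_visits[of m "\<lambda>s. A s \<omega>" a T] m by (simp add: sum.distrib)
  finally show ?thesis .
qed

text \<open>A sample below \<open>- D * N / \<sigma>\<close> cancels any deviation allowed by
  \<open>good\<close>, whatever the number of pulls, so the forced events need not refer to the
  past. The range of \<open>x\<close> ends at \<open>1 + pulls\<close>, the final value of
  \<open>nbar\<close>.\<close>

lemma pulls_ge_forced:
  assumes \<omega>: "\<omega> \<in> space M" and a: "a \<in> arms" and D: "D > 0" and N: "N \<ge> 1"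
    and good: "\<And>b. b \<in> arms \<Longrightarrow> good b D N T \<omega>"
    and y: "\<And>b. b \<in> arms \<Longrightarrow> \<mu> b + D \<le> y"
    and v: "\<And>x. 1 \<le> x \<Longrightarrow> x \<le> 1 + pulls (\<lambda>s. A s \<omega>) a T \<Longrightarrow> level \<sigma> D N (y - \<mu> a) x \<le> v"
  shows "(\<Sum>t<T. of_bool (\<omega> \<in> forced a v (D * real N / \<sigma>) t)) \<le> pulls (\<lambda>s. A s \<omega>) a T"
  unfolding pulls_eq_sum
proof (rule sum_mono)
  fix t assume "t \<in> {..<T}"
  then have t: "t < T" by simp
  show "of_bool (\<omega> \<in> forced a v (D * real N / \<sigma>) t) \<le> (of_bool (A (Suc t) \<omega> = a) :: real)"
  proof (cases "\<omega> \<in> forced a v (D * real N / \<sigma>) t")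
    case True
    have dev: "\<bar>dev b t \<omega>\<bar> / n b t \<omega> \<le> D * max (n b t \<omega>) (real N) / n b t \<omega>" if "b \<in> arms" for b
      using good[OF that] t nbar_ge_1[of "\<lambda>s. A s \<omega>" b t]
      by (intro divide_right_mono) (auto simp: good_def intro: less_imp_le)
    have low: "index b t \<omega> \<le> y" if b: "b \<in> arms" "b \<noteq> a" for b
    proof -
      let ?n = "n b t \<omega>"
      have n: "?n \<ge> 1" by (rule nbar_ge_1)
      have sq: "sqrt ?n \<le> ?n" "sqrt ?n > 0"
        using n real_sqrt_le_mono[of ?n "?n\<^sup>2"] by (auto simp: power2_eq_square)
      have "Z b (Suc t) \<omega> \<le> - (D * real N / \<sigma>)" using True b by (auto simp: forced_def)
      then have "\<sigma> / sqrt ?n * Z b (Suc t) \<omega> \<le> \<sigma> / sqrt ?n * (- (D * real N / \<sigma>))"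
        using sigma_pos sq by (intro mult_left_mono) auto
      also have "\<dots> = - (D * real N / sqrt ?n)" using sigma_pos by simp
      finally have "\<sigma> / sqrt ?n * Z b (Suc t) \<omega> \<le> - (D * real N / sqrt ?n)" .
      \<comment> \<open>With at least \<open>N\<close> observations the error is at most
        \<open>D\<close> already; with fewer, \<open>sqrt n \<le> n\<close> lets the negative sample
        outweigh it.\<close>
      moreover have "D * max ?n (real N) / ?n - D * real N / sqrt ?n \<le> D"
      proof (cases "real N \<le> ?n")
        case True
        then show ?thesis using n D sq by (simp add: max_def)
      next
        case False
        have "D * real N / ?n \<le> D * real N / sqrt ?n"
          using D sq n by (intro divide_left_mono) auto
        then show ?thesis using False D by (simp add: max_def)
      qed
      moreover have "dev b t \<omega> / ?n \<le> \<bar>dev b t \<omega>\<bar> / ?n" using n by (intro divide_right_mono) auto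
      ultimately show ?thesis using dev[OF b(1)] y[OF b(1)]
        by (simp add: index_def estimate_eq)
    qed
    have "y < index a t \<omega>"
    proof -
      let ?n = "n a t \<omega>"
      have n: "?n \<ge> 1" by (rule nbar_ge_1)
      have "?n \<le> 1 + pulls (\<lambda>s. A s \<omega>) a T"
        using nbar_mono[of t T "\<lambda>s. A s \<omega>" a] t by (simp add: nbar_eq_pulls)
      with v[OF n] True have "level \<sigma> D N (y - \<mu> a) ?n < Z a (Suc t) \<omega>"
        by (force simp: forced_def)
      then have "\<sigma> / sqrt ?n * level \<sigma> D N (y - \<mu> a) ?n < \<sigma> / sqrt ?n * Z a (Suc t) \<omega>"
        using sigma_pos n by (intro mult_strict_left_mono) auto
      also have "\<sigma> / sqrt ?n * level \<sigma> D N (y - \<mu> a) ?n = y - \<mu> a + D * max ?n (real N) / ?n"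
        using sigma_pos n by (simp add: level_def)
      finally have 1: "y - \<mu> a + D * max ?n (real N) / ?n < \<sigma> / sqrt ?n * Z a (Suc t) \<omega>" .
      have "- (\<bar>dev a t \<omega>\<bar> / ?n) \<le> dev a t \<omega> / ?n" using n by (simp add: divide_simps)
      with 1 dev[OF a] show ?thesis by (simp add: index_def estimate_eq)
    qed
    then have "A (Suc t) \<omega> = a"
      using low arm_in_arms[OF \<omega>, of t] index_le_index_arm[OF \<omega> a, of t] by (metis leD order_less_le_trans)
    then show ?thesis by simp
  qed simp
qed

text \<open>A union bound over four failures: an arm is not concentrated, there are \<open>c\<close>
  or more shortfalls, a sample of an arm in \<open>B\<close> exceeds \<open>v\<close>, or forced
  pulls are too few.\<close>

lemma prob_pulls_between:
  assumes best: "best \<in> arms" "\<And>b. b \<in> arms \<Longrightarrow> \<mu> b \<le> \<mu> best"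
    and B: "B \<subseteq> arms" and D: "D > 0" and N: "N \<ge> 1" and c: "c > 0" and T: "T \<ge> 1"
    and m: "\<And>b. b \<in> arms \<Longrightarrow> \<bar>\<mu> b\<bar> \<le> m"
    and S: "S = (\<Sum>k. law.odds (level \<sigma> D N (- 2 * D) (real (Suc k))))"
    and r: "r = tail \<nu> w * cdf \<nu> (- (D * real N / \<sigma>)) ^ (K - 1)"
    and up: "\<And>a. a \<in> B \<Longrightarrow> real N \<le> up a" "\<And>a. a \<in> B \<Longrightarrow> 0 \<le> \<mu> best - \<mu> a - 3 * D"
      "\<And>a. a \<in> B \<Longrightarrow> v \<le> (\<mu> best - \<mu> a - 3 * D) * sqrt (up a) / \<sigma>"
    and lo: "\<And>a x. a \<in> B \<Longrightarrow> 1 \<le> x \<Longrightarrow> x \<le> 1 + lo a \<Longrightarrow> level \<sigma> D N (\<mu> best + D - \<mu> a) x \<le> w"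
      "\<And>a. a \<in> B \<Longrightarrow> lo a \<le> real T * r / 2"
  shows "prob {\<omega> \<in> space M. \<forall>a\<in>B. lo a \<le> pulls (\<lambda>s. A s \<omega>) a T \<and> pulls (\<lambda>s. A s \<omega>) a T \<le> up a + c} \<ge>
    1 - (real K * ((m\<^sup>2 / (real N)\<^sup>2 + 2 * \<sigma>\<^sup>2 / real N) / D\<^sup>2) + S / c +
      real (card B) * (real T * tail \<nu> v + 4 / (real T * r)))"
    (is "prob ?E \<ge> 1 - ?p")
proof -
  \<comment> \<open>Below the best mean, one \<open>D\<close> covers the estimation error of
    \<open>best\<close> and the second keeps its level negative, so that \<open>S\<close> converges.
    The third \<open>D\<close> in the bounds for \<open>up\<close> is the error of arm
    \<open>a\<close>.\<close>
  let ?x = "D * real N / \<sigma>" and ?y = "\<mu> best - 2 * D"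
  define G where "G b = {\<omega> \<in> space M. \<not> good b D N T \<omega>}" for b
  define H where "H = {\<omega> \<in> space M. c \<le> (\<Sum>t<T. of_bool (\<omega> \<in> shortfall best D N ?y t))}"
  define U where "U a t = {\<omega> \<in> space M. v < Z a (Suc t) \<omega>}" for a t
  define L where "L a = {\<omega> \<in> space M. (\<Sum>t<T. of_bool (\<omega> \<in> forced a w ?x t)) \<le> real T * r / 2}" for a
  have finB: "finite B" using B by (rule finite_subset) simp
  have Ba: "a \<in> arms" if "a \<in> B" for a using B that by blast
  have G [measurable]: "G b \<in> events" for b unfolding G_def by measurable
  have H [measurable]: "H \<in> events"
  proof -
    have "(\<lambda>\<omega>. \<Sum>t<T. indicator (shortfall best D N ?y t) \<omega> :: real) \<in> borel_measurable M" by measurable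
    then have "{\<omega> \<in> space M. c \<le> (\<Sum>t<T. indicator (shortfall best D N ?y t) \<omega> :: real)} \<in> events" by measurable
    then show ?thesis by (simp add: H_def indicator_def of_bool_def)
  qed
  have U [measurable]: "U a t \<in> events" if "a \<in> B" for a t using Ba[OF that] unfolding U_def by measurable
  have L [measurable]: "L a \<in> events" if "a \<in> B" for a
  proof -
    note [measurable] = sets_forced[OF Ba[OF that]]
    have "(\<lambda>\<omega>. \<Sum>t<T. indicator (forced a w ?x t) \<omega> :: real) \<in> borel_measurable M" by measurable
    then have "{\<omega> \<in> space M. (\<Sum>t<T. indicator (forced a w ?x t) \<omega> :: real) \<le> real T * r / 2} \<in> events" by measurable
    then show ?thesis by (simp add: L_def indicator_def of_bool_def)
  qed
  have "prob (G b) \<le> (m\<^sup>2 / (real N)\<^sup>2 + 2 * \<sigma>\<^sup>2 / real N) / D\<^sup>2" if "b \<in> arms" for b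
  proof -
    have "(\<mu> b)\<^sup>2 \<le> m\<^sup>2" using m[OF that] by (metis abs_ge_zero power2_abs power_mono)
    then have "((\<mu> b)\<^sup>2 / (real N)\<^sup>2 + 2 * \<sigma>\<^sup>2 / real N) / D\<^sup>2 \<le> (m\<^sup>2 / (real N)\<^sup>2 + 2 * \<sigma>\<^sup>2 / real N) / D\<^sup>2"
      by (intro divide_right_mono add_right_mono) auto
    then show ?thesis using prob_not_good[OF N D, of b T] by (simp add: G_def)
  qed
  then have "(\<Sum>b\<in>arms. prob (G b)) \<le> real (card arms) * ((m\<^sup>2 / (real N)\<^sup>2 + 2 * \<sigma>\<^sup>2 / real N) / D\<^sup>2)"
    by (rule sum_bounded_above)
  then have pG: "prob (\<Union>b\<in>arms. G b) \<le> real K * ((m\<^sup>2 / (real N)\<^sup>2 + 2 * \<sigma>\<^sup>2 / real N) / D\<^sup>2)"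
    using finite_measure_subadditive_finite[of arms G] G by (simp add: image_subset_iff)
  have pH: "prob H \<le> S / c"
  proof -
    have "?y - \<mu> best = - 2 * D" by simp
    then show ?thesis
      using prob_many_shortfalls[OF best(1), of D N ?y c T] law.summable_odds_level[OF sigma_pos, of "- 2 * D" D N] D c
      unfolding H_def S by simp
  qed
  have "prob ((\<Union>t<T. U a t) \<union> L a) \<le> real T * tail \<nu> v + 4 / (real T * r)" if a: "a \<in> B" for a
  proof -
    have "prob (U a t) = tail \<nu> v" for t
    proof -
      have "prob (U a t) = measure (distr M borel (Z a (Suc t))) {v<..}"
        using Ba[OF a] by (subst measure_distr) (auto simp: U_def intro!: arg_cong[where f = prob])
      then show ?thesis using sampling_law[of a "Suc t"] Ba[OF a] by (simp add: law.measure_greaterThan)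
    qed
    then have "prob (\<Union>t<T. U a t) \<le> real T * tail \<nu> v"
      using finite_measure_subadditive_finite[of "{..<T}" "U a"] U[OF a] by auto
    moreover have "prob (L a) \<le> 4 / (real T * r)"
      unfolding L_def using Ba[OF a] T r by (rule prob_few_forced)
    ultimately show ?thesis
      using measure_Un_le[of "\<Union>t<T. U a t" M "L a"] U[OF a] L[OF a] by force
  qed
  then have "(\<Sum>a\<in>B. prob ((\<Union>t<T. U a t) \<union> L a)) \<le> real (card B) * (real T * tail \<nu> v + 4 / (real T * r))"
    by (intro sum_bounded_above) auto
  moreover have "prob (\<Union>a\<in>B. (\<Union>t<T. U a t) \<union> L a) \<le> (\<Sum>a\<in>B. prob ((\<Union>t<T. U a t) \<union> L a))"
    using finB U L by (intro finite_measure_subadditive_finite) auto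
  ultimately have pB: "prob (\<Union>a\<in>B. (\<Union>t<T. U a t) \<union> L a) \<le> real (card B) * (real T * tail \<nu> v + 4 / (real T * r))"
    by linarith
  let ?bad = "(\<Union>b\<in>arms. G b) \<union> H \<union> (\<Union>a\<in>B. (\<Union>t<T. U a t) \<union> L a)"
  have bad [measurable]: "?bad \<in> events" using finB by measurable
  have "prob ?bad \<le> prob ((\<Union>b\<in>arms. G b) \<union> H) + prob (\<Union>a\<in>B. (\<Union>t<T. U a t) \<union> L a)"
    by (rule measure_Un_le) (use finB in measurable)
  also have "prob ((\<Union>b\<in>arms. G b) \<union> H) \<le> prob (\<Union>b\<in>arms. G b) + prob H"
    by (rule measure_Un_le) measurable
  finally have "prob ?bad \<le> ?p" using pG pH pB by linarith
  moreover have "space M - ?bad \<subseteq> ?E"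
  proof
    fix \<omega> assume "\<omega> \<in> space M - ?bad"
    then have \<omega>: "\<omega> \<in> space M" and good: "\<And>b. b \<in> arms \<Longrightarrow> good b D N T \<omega>"
      and H: "(\<Sum>t<T. of_bool (\<omega> \<in> shortfall best D N ?y t)) < c"
      and U: "\<And>a t. a \<in> B \<Longrightarrow> t < T \<Longrightarrow> Z a (Suc t) \<omega> \<le> v"
      and L: "\<And>a. a \<in> B \<Longrightarrow> real T * r / 2 < (\<Sum>t<T. of_bool (\<omega> \<in> forced a w ?x t))"
      by (auto simp: G_def H_def U_def L_def not_le not_less)
    have "lo a \<le> pulls (\<lambda>s. A s \<omega>) a T" if a: "a \<in> B" for a
    proof (rule ccontr)
      \<comment> \<open>With a final count below \<open>lo a\<close>, the level bound covers every
        value of \<open>nbar\<close> that occurs, so each forced event yields a pull; these are more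
        than \<open>T * r / 2\<close>, hence more than \<open>lo a\<close>.\<close>
      assume *: "\<not> lo a \<le> pulls (\<lambda>s. A s \<omega>) a T"
      have "(\<Sum>t<T. of_bool (\<omega> \<in> forced a w ?x t)) \<le> pulls (\<lambda>s. A s \<omega>) a T"
        by (rule pulls_ge_forced[OF \<omega> Ba[OF a] D N good, where y = "\<mu> best + D"])
          (use best(2) lo(1)[OF a] * in auto)
      with * L[OF a] lo(2)[OF a] show False by linarith
    qed
    moreover have "pulls (\<lambda>s. A s \<omega>) a T \<le> up a + c" if a: "a \<in> B" for a
    proof -
      have "pulls (\<lambda>s. A s \<omega>) a T \<le> up a + (\<Sum>t<T. of_bool (\<omega> \<in> shortfall best D N ?y t))"
        by (rule pulls_le[OF \<omega> D good[OF Ba[OF a]] good[OF best(1)]])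
          (use up[OF a] U[OF a] in \<open>auto simp: algebra_simps\<close>)
      with H show ?thesis by linarith
    qed
    ultimately show "\<omega> \<in> ?E" using \<omega> by blast
  qed
  moreover have "?E \<in> events"
  proof -
    have "pulls (\<lambda>s. A s \<omega>) a T = n a T \<omega> - 1" for a \<omega> by (simp add: nbar_eq_pulls)
    then show ?thesis using finB by simp
  qed
  then have "prob (space M - ?bad) \<le> prob ?E"
    using \<open>space M - ?bad \<subseteq> ?E\<close> by (intro finite_measure_mono) auto
  ultimately show ?thesis using prob_compl[OF bad] by linarith
qed

end

section \<open>Elementary estimates for the final choice of constants\<close>

lemma (in sampling_distribution) eventually_q_ge: "\<forall>\<^sub>F T in sequentially. x \<le> q T"
  using q_at_top by (simp add: filterlim_at_top)

lemma (in sampling_distribution) eventually_q_square_ge: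
  assumes "C > 0"
  shows "\<forall>\<^sub>F T in sequentially. x \<le> C * (q T)\<^sup>2"
  using eventually_q_ge[of "max 1 (x / C)"]
proof eventually_elim
  case (elim T)
  then have q: "1 \<le> q T" "x / C \<le> q T" by simp_all
  then have "x / C \<le> q T * 1" by simp
  also have "\<dots> \<le> q T * q T" using q by (intro mult_left_mono) auto
  finally show ?case using assms by (simp add: power2_eq_square field_simps)
qed

text \<open>Raising the pull count by the factor \<open>1 + \<epsilon> / 2\<close> outweighs the
  loss of a tenth of \<epsilon> in the gap; the surplus is the factor by which samples must exceed
  the quantile.\<close>

lemma upper_factor_gt_1:
  fixes \<epsilon> :: real
  assumes "0 < \<epsilon>" "\<epsilon> < 1 / 2"
  shows "1 < (1 - \<epsilon> / 10) * sqrt (1 + \<epsilon> / 2)"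
proof (rule power2_less_imp_less)
  have "0 < \<epsilon> * (3 / 10 - 9 / 100 * \<epsilon> + \<epsilon>\<^sup>2 / 200)"
    using assms by (intro mult_pos_pos add_pos_nonneg) auto
  moreover have "((1 - \<epsilon> / 10) * sqrt (1 + \<epsilon> / 2))\<^sup>2 = 1 + \<epsilon> * (3 / 10 - 9 / 100 * \<epsilon> + \<epsilon>\<^sup>2 / 200)"
    using assms by (simp add: power_mult_distrib) (simp add: power2_eq_square field_simps)
  ultimately show "1\<^sup>2 < ((1 - \<epsilon> / 10) * sqrt (1 + \<epsilon> / 2))\<^sup>2" by simp
qed (use assms in auto)

lemma lower_factor_less_1:
  fixes \<epsilon> :: real
  assumes "0 < \<epsilon>" "\<epsilon> < 1 / 2"
  shows "(1 + \<epsilon> / 10) * sqrt (1 - \<epsilon> / 2) < 1"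
proof (rule power2_less_imp_less)
  have "0 < \<epsilon> * (3 / 10 + 9 / 100 * \<epsilon> + \<epsilon>\<^sup>2 / 200)"
    using assms by (intro mult_pos_pos add_pos_nonneg) auto
  moreover have "((1 + \<epsilon> / 10) * sqrt (1 - \<epsilon> / 2))\<^sup>2 = 1 - \<epsilon> * (3 / 10 + 9 / 100 * \<epsilon> + \<epsilon>\<^sup>2 / 200)"
    using assms by (simp add: power_mult_distrib) (simp add: power2_eq_square field_simps)
  ultimately show "((1 + \<epsilon> / 10) * sqrt (1 - \<epsilon> / 2))\<^sup>2 < 1\<^sup>2" by simp
qed auto

text \<open>The first entry bounds the range \<open>x \<le> N\<close> and does not depend on
  \<open>m\<close>; a growing quantile eventually dominates it.\<close>

lemma level_le:
  assumes "\<sigma> > 0" "D > 0" "d \<ge> 0" "1 \<le> x" "x \<le> m" "N \<ge> 1"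
  shows "level \<sigma> D N d x \<le> max ((d + D * real N) * sqrt (real N) / \<sigma>) ((d + D) * sqrt m / \<sigma>)"
proof (cases "x \<le> real N")
  case True
  have "level \<sigma> D N d x \<le> (d + D * real N) * sqrt (real N) / \<sigma>"
    unfolding level_def
  proof (intro divide_right_mono mult_mono add_left_mono)
    have "real N / x \<le> real N / 1" using assms by (intro divide_left_mono) auto
    then show "D * max x (real N) / x \<le> D * real N" using True assms
      by (simp add: max_absorb2) (metis mult_left_mono less_imp_le times_divide_eq_right)
  qed (use assms True in auto)
  then show ?thesis by simp
next
  case False
  then have "level \<sigma> D N d x = (d + D) * sqrt x / \<sigma>" using assms by (simp add: level_def)
  also have "\<dots> \<le> (d + D) * sqrt m / \<sigma>"
    using assms by (intro divide_right_mono mult_left_mono) auto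
  finally show ?thesis by simp
qed

theorem theorem2p1:
  fixes K :: nat and \<mu> :: "nat \<Rightarrow> real" and \<sigma> \<epsilon> :: real and \<nu> :: "real measure"
  assumes "K \<ge> 1" and "\<sigma> > 0"
    and "real_distribution \<nu>" and "cond_B1 \<nu>" and "cond_B2 \<nu>"
    and "0 < \<epsilon>" and "\<epsilon> < 1 / 2"
  shows "\<exists>c0>1. \<forall>(M :: 'w measure) \<xi> Z A. thompson_sampling M K \<mu> \<sigma> \<nu> \<xi> Z A \<longrightarrow>
    (INF T\<in>{T :: nat. c0 \<le> real T}.
       measure M {\<omega> \<in> space M. \<forall>a\<in>suboptimal_arms K \<mu>.
         1 - \<epsilon> \<le> (pulls (\<lambda>s. A s \<omega>) a T / \<sigma>\<^sup>2) / (gen_inverse (tail \<nu>) (1 / real T) / gap K \<mu> a)\<^sup>2 \<and>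
         (pulls (\<lambda>s. A s \<omega>) a T / \<sigma>\<^sup>2) / (gen_inverse (tail \<nu>) (1 / real T) / gap K \<mu> a)\<^sup>2
           \<le> 1 + \<epsilon> + c0 / (gen_inverse (tail \<nu>) (1 / real T))\<^sup>2})
    \<ge> 1 - \<epsilon>"
proof -
  interpret law: sampling_distribution \<nu>
    using assms by (simp add: sampling_distribution_def sampling_distribution_axioms_def)

  \<comment> \<open>Constants that do not depend on the run\<close>
  define B where "B = suboptimal_arms K \<mu>"
  define \<Delta> where "\<Delta> = gap K \<mu>"
  have B: "B \<subseteq> {1..K}" "finite B" and \<Delta>_pos: "\<And>a. a \<in> B \<Longrightarrow> \<Delta> a > 0"
    by (auto simp: B_def \<Delta>_def suboptimal_arms_def)
  have "Max (\<mu> ` {1..K}) \<in> \<mu> ` {1..K}" using \<open>K \<ge> 1\<close> by (intro Max_in) auto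
  then obtain best where best: "best \<in> {1..K}" "Max (\<mu> ` {1..K}) = \<mu> best" by auto
  then have best_le: "\<mu> b \<le> \<mu> best" if "b \<in> {1..K}" for b
    using that Max_ge[of "\<mu> ` {1..K}" "\<mu> b"] by auto
  have \<Delta>_eq: "\<Delta> a = \<mu> best - \<mu> a" for a using best by (simp add: \<Delta>_def gap_def)
  \<comment> \<open>Chosen so that \<open>3 * D\<close> costs at most a tenth of \<epsilon> of every
    positive gap. The inserted 1 keeps the minimum defined when there are no suboptimal
    arms.\<close>
  define D where "D = Min (insert 1 ((\<lambda>a. \<epsilon> / 30 * \<Delta> a) ` B))"
  have D: "D > 0" and D_le: "\<And>a. a \<in> B \<Longrightarrow> D \<le> \<epsilon> / 30 * \<Delta> a"
    unfolding D_def using B \<Delta>_pos \<open>0 < \<epsilon>\<close> by simp (rule Min_le, use B in auto)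
  define m where "m = Max ((\<lambda>b. \<bar>\<mu> b\<bar>) ` {1..K})"
  have m: "\<bar>\<mu> b\<bar> \<le> m" if "b \<in> {1..K}" for b using that by (auto simp: m_def)
  \<comment> \<open>A large \<open>N\<close> brings the failure probability of concentration, over
    all \<open>K\<close> arms, to at most \<open>\<epsilon> / 4\<close>.\<close>
  have "(\<lambda>N. real K * ((m\<^sup>2 * (1 / real N * (1 / real N)) + 2 * \<sigma>\<^sup>2 * (1 / real N)) / D\<^sup>2)) \<longlonglongrightarrow>
      real K * ((m\<^sup>2 * (0 * 0) + 2 * \<sigma>\<^sup>2 * 0) / D\<^sup>2)"
    using D by (intro tendsto_intros lim_1_over_n) auto
  then have "\<forall>\<^sub>F N in sequentially. real K * ((m\<^sup>2 * (1 / real N * (1 / real N)) + 2 * \<sigma>\<^sup>2 * (1 / real N)) / D\<^sup>2) < \<epsilon> / 4"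
    using \<open>0 < \<epsilon>\<close> by (intro order_tendstoD) auto
  then have "\<forall>\<^sub>F N in sequentially. N \<ge> 1 \<and> real K * ((m\<^sup>2 * (1 / real N * (1 / real N)) + 2 * \<sigma>\<^sup>2 * (1 / real N)) / D\<^sup>2) < \<epsilon> / 4"
    using eventually_ge_at_top[of 1] by eventually_elim simp
  then obtain N :: nat where N: "N \<ge> 1"
    and pG: "real K * ((m\<^sup>2 / (real N)\<^sup>2 + 2 * \<sigma>\<^sup>2 / real N) / D\<^sup>2) \<le> \<epsilon> / 4"
    by (auto simp: eventually_sequentially power2_eq_square less_imp_le)
  define S where "S = (\<Sum>k. law.odds (level \<sigma> D N (- 2 * D) (real (Suc k))))"
  have S: "S \<ge> 0" unfolding S_def
    using D \<open>\<sigma> > 0\<close> by (intro suminf_nonneg law.summable_odds_level law.odds_nonneg) auto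
  \<comment> \<open>Markov's inequality with mean at most \<open>S\<close> then costs at most
    \<open>\<epsilon> / 4\<close>; the summand 1 ensures \<open>c > 0\<close>.\<close>
  define c where "c = 4 * S / \<epsilon> + 1"
  have c: "c > 0" "S / c \<le> \<epsilon> / 4"
    using S \<open>0 < \<epsilon>\<close> by (auto simp: c_def add_nonneg_pos field_simps)
  define \<rho> where "\<rho> = cdf \<nu> (- (D * real N / \<sigma>)) ^ (K - 1)"
  have \<rho>: "\<rho> > 0" using law.cdf_bounds(1) by (simp add: \<rho>_def)
  define cu where "cu = (1 - \<epsilon> / 10) * sqrt (1 + \<epsilon> / 2)"
  define cl where "cl = 1 / ((1 + \<epsilon> / 10) * sqrt (1 - \<epsilon> / 2))"
  have cu: "cu > 1" using upper_factor_gt_1 assms by (simp add: cu_def)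
  have cl: "cl > 1" using lower_factor_less_1 assms by (simp add: cl_def)
  let ?q = "\<lambda>T. gen_inverse (tail \<nu>) (1 / real T)"
  define r where "r T = tail \<nu> (?q T / cl) * \<rho>" for T
  \<comment> \<open>Only half of \<epsilon> is spent here, so that the other half can absorb the
    additive constant \<open>c\<close>.\<close>
  define up where "up T a = (1 + \<epsilon> / 2) * \<sigma>\<^sup>2 * (?q T)\<^sup>2 / (\<Delta> a)\<^sup>2" for T a
  define lo where "lo T a = (1 - \<epsilon>) * \<sigma>\<^sup>2 * (?q T)\<^sup>2 / (\<Delta> a)\<^sup>2" for T a
  have r_pos: "r T > 0" for T using \<rho> law.tail_bounds(1) by (simp add: r_def)

  \<comment> \<open>Requirements on the horizon\<close>
  have "\<forall>\<^sub>F T in sequentially. T \<ge> 2 \<and> ?q T \<ge> 1"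
    using eventually_ge_at_top[of 2] law.eventually_q_ge[of 1] by eventually_elim simp
  moreover have "\<forall>\<^sub>F T in sequentially. real (card B) * (real T * tail \<nu> (cu * ?q T)) < \<epsilon> / 4"
    using tendsto_mult_right_zero[OF law.times_tail_tendsto_0[OF cu], of "real (card B)"] \<open>0 < \<epsilon>\<close>
    by (intro order_tendstoD) auto
  moreover have "\<forall>\<^sub>F T in sequentially. (4 * real (card B) / \<rho>) * ((?q T)\<^sup>2 / (real T * tail \<nu> (?q T / cl))) < \<epsilon> / 4"
    using tendsto_mult_right_zero[OF law.square_over_times_tail_tendsto_0[OF cl], of "4 * real (card B) / \<rho>"] \<open>0 < \<epsilon>\<close>
    by (intro order_tendstoD) auto
  moreover have "\<forall>\<^sub>F T in sequentially. \<forall>a\<in>B. real N \<le> up T a \<and> c \<le> (\<epsilon> / 2 * \<sigma>\<^sup>2 / (\<Delta> a)\<^sup>2) * (?q T)\<^sup>2 \<and>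
      1 \<le> (\<epsilon> / 2 * \<sigma>\<^sup>2 / (\<Delta> a)\<^sup>2) * (?q T)\<^sup>2 \<and>
      (\<mu> best + D - \<mu> a + D * real N) * sqrt (real N) / \<sigma> * cl \<le> ?q T \<and>
      (2 * \<sigma>\<^sup>2 / (\<rho> * (\<Delta> a)\<^sup>2)) * ((?q T)\<^sup>2 / (real T * tail \<nu> (?q T / cl))) < 1"
  proof (intro eventually_ball_finite B ballI)
    fix a assume "a \<in> B"
    then have \<Delta>: "\<Delta> a > 0" by (rule \<Delta>_pos)
    have "\<forall>\<^sub>F T in sequentially. real N \<le> ((1 + \<epsilon> / 2) * \<sigma>\<^sup>2 / (\<Delta> a)\<^sup>2) * (?q T)\<^sup>2"
      using \<Delta> assms by (intro law.eventually_q_square_ge) auto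
    moreover have "\<forall>\<^sub>F T in sequentially. max 1 c \<le> (\<epsilon> / 2 * \<sigma>\<^sup>2 / (\<Delta> a)\<^sup>2) * (?q T)\<^sup>2"
      using \<Delta> assms by (intro law.eventually_q_square_ge) auto
    moreover note law.eventually_q_ge[of "(\<mu> best + D - \<mu> a + D * real N) * sqrt (real N) / \<sigma> * cl"]
    moreover have "\<forall>\<^sub>F T in sequentially. (2 * \<sigma>\<^sup>2 / (\<rho> * (\<Delta> a)\<^sup>2)) * ((?q T)\<^sup>2 / (real T * tail \<nu> (?q T / cl))) < 1"
      using tendsto_mult_right_zero[OF law.square_over_times_tail_tendsto_0[OF cl], of "2 * \<sigma>\<^sup>2 / (\<rho> * (\<Delta> a)\<^sup>2)"]
      by (intro order_tendstoD) auto
    ultimately show "\<forall>\<^sub>F T in sequentially. real N \<le> up T a \<and> c \<le> (\<epsilon> / 2 * \<sigma>\<^sup>2 / (\<Delta> a)\<^sup>2) * (?q T)\<^sup>2 \<and>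
        1 \<le> (\<epsilon> / 2 * \<sigma>\<^sup>2 / (\<Delta> a)\<^sup>2) * (?q T)\<^sup>2 \<and>
        (\<mu> best + D - \<mu> a + D * real N) * sqrt (real N) / \<sigma> * cl \<le> ?q T \<and>
        (2 * \<sigma>\<^sup>2 / (\<rho> * (\<Delta> a)\<^sup>2)) * ((?q T)\<^sup>2 / (real T * tail \<nu> (?q T / cl))) < 1"
      by eventually_elim (simp add: up_def)
  qed
  ultimately have "\<forall>\<^sub>F T in sequentially. (T \<ge> 2 \<and> ?q T \<ge> 1) \<and>
      real (card B) * (real T * tail \<nu> (cu * ?q T)) < \<epsilon> / 4 \<and>
      (4 * real (card B) / \<rho>) * ((?q T)\<^sup>2 / (real T * tail \<nu> (?q T / cl))) < \<epsilon> / 4 \<and>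
      (\<forall>a\<in>B. real N \<le> up T a \<and> c \<le> (\<epsilon> / 2 * \<sigma>\<^sup>2 / (\<Delta> a)\<^sup>2) * (?q T)\<^sup>2 \<and>
        1 \<le> (\<epsilon> / 2 * \<sigma>\<^sup>2 / (\<Delta> a)\<^sup>2) * (?q T)\<^sup>2 \<and>
        (\<mu> best + D - \<mu> a + D * real N) * sqrt (real N) / \<sigma> * cl \<le> ?q T \<and>
        (2 * \<sigma>\<^sup>2 / (\<rho> * (\<Delta> a)\<^sup>2)) * ((?q T)\<^sup>2 / (real T * tail \<nu> (?q T / cl))) < 1)"
    by eventually_elim blast
  then obtain T0 where T0: "\<And>T. T \<ge> T0 \<Longrightarrow> T \<ge> 2 \<and> ?q T \<ge> 1"
    "\<And>T. T \<ge> T0 \<Longrightarrow> real (card B) * (real T * tail \<nu> (cu * ?q T)) < \<epsilon> / 4"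
    "\<And>T. T \<ge> T0 \<Longrightarrow> (4 * real (card B) / \<rho>) * ((?q T)\<^sup>2 / (real T * tail \<nu> (?q T / cl))) < \<epsilon> / 4"
    "\<And>T a. T \<ge> T0 \<Longrightarrow> a \<in> B \<Longrightarrow> real N \<le> up T a"
    "\<And>T a. T \<ge> T0 \<Longrightarrow> a \<in> B \<Longrightarrow> c \<le> (\<epsilon> / 2 * \<sigma>\<^sup>2 / (\<Delta> a)\<^sup>2) * (?q T)\<^sup>2"
    "\<And>T a. T \<ge> T0 \<Longrightarrow> a \<in> B \<Longrightarrow> 1 \<le> (\<epsilon> / 2 * \<sigma>\<^sup>2 / (\<Delta> a)\<^sup>2) * (?q T)\<^sup>2"
    "\<And>T a. T \<ge> T0 \<Longrightarrow> a \<in> B \<Longrightarrow> (\<mu> best + D - \<mu> a + D * real N) * sqrt (real N) / \<sigma> * cl \<le> ?q T"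
    "\<And>T a. T \<ge> T0 \<Longrightarrow> a \<in> B \<Longrightarrow> (2 * \<sigma>\<^sup>2 / (\<rho> * (\<Delta> a)\<^sup>2)) * ((?q T)\<^sup>2 / (real T * tail \<nu> (?q T / cl))) < 1"
    unfolding eventually_sequentially by blast
  \<comment> \<open>Determined by \<open>K\<close>, \<mu>, \<sigma>, \<epsilon> and \<nu> before any
    run is introduced.\<close>
  define c0 where "c0 = max 2 (real T0)"

  \<comment> \<open>The estimate for an arbitrary run\<close>
  show ?thesis
  proof (intro exI[of _ c0] conjI allI impI)
    show "c0 > 1" by (simp add: c0_def)
    fix M :: "'w measure" and \<xi> Z A
    assume "thompson_sampling M K \<mu> \<sigma> \<nu> \<xi> Z A"
    then interpret thompson_sampling M K \<mu> \<sigma> \<nu> \<xi> Z A .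
    interpret thompson_run M K \<mu> \<sigma> \<nu> \<xi> Z A by unfold_locales (rule \<open>\<sigma> > 0\<close>)
    show "(INF T\<in>{T :: nat. c0 \<le> real T}.
       measure M {\<omega> \<in> space M. \<forall>a\<in>suboptimal_arms K \<mu>.
         1 - \<epsilon> \<le> (pulls (\<lambda>s. A s \<omega>) a T / \<sigma>\<^sup>2) / (?q T / gap K \<mu> a)\<^sup>2 \<and>
         (pulls (\<lambda>s. A s \<omega>) a T / \<sigma>\<^sup>2) / (?q T / gap K \<mu> a)\<^sup>2 \<le> 1 + \<epsilon> + c0 / (?q T)\<^sup>2}) \<ge> 1 - \<epsilon>"
      unfolding B_def[symmetric] \<Delta>_def[symmetric]
    proof (rule cINF_greatest)
      show "{T :: nat. c0 \<le> real T} \<noteq> {}" using real_arch_simple[of c0] by auto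
      fix T assume "T \<in> {T :: nat. c0 \<le> real T}"
      then have T: "T \<ge> T0" by (simp add: c0_def)
      note ev = T0[OF T]
      have q: "?q T \<ge> 1" and T1: "T \<ge> 1" using ev(1) by auto
      let ?E = "{\<omega> \<in> space M. \<forall>a\<in>B. lo T a \<le> pulls (\<lambda>s. A s \<omega>) a T \<and> pulls (\<lambda>s. A s \<omega>) a T \<le> up T a + c}"
      have "1 - (real K * ((m\<^sup>2 / (real N)\<^sup>2 + 2 * \<sigma>\<^sup>2 / real N) / D\<^sup>2) + S / c +
          real (card B) * (real T * tail \<nu> (cu * ?q T) + 4 / (real T * r T))) \<le> prob ?E"
      proof (rule prob_pulls_between[OF best(1) best_le B(1) D N c(1) T1 m S_def])
        show "r T = tail \<nu> (?q T / cl) * cdf \<nu> (- (D * real N / \<sigma>)) ^ (K - 1)"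
          by (simp add: r_def \<rho>_def)
      next
        fix a assume a: "a \<in> B"
        note \<Delta> = \<Delta>_pos[OF a] and Da = D_le[OF a]
        show "real N \<le> up T a" by (rule ev(4)[OF a])
        have 3: "(1 - \<epsilon> / 10) * \<Delta> a \<le> \<mu> best - \<mu> a - 3 * D"
          using Da by (simp add: \<Delta>_eq algebra_simps)
        moreover have "0 \<le> (1 - \<epsilon> / 10) * \<Delta> a" using \<Delta> assms by simp
        ultimately show "0 \<le> \<mu> best - \<mu> a - 3 * D" by linarith
        have sq: "sqrt (up T a) = sqrt (1 + \<epsilon> / 2) * \<sigma> * ?q T / \<Delta> a"
          using \<Delta> q assms by (simp add: up_def real_sqrt_mult real_sqrt_divide)
        have "cu * ?q T = (1 - \<epsilon> / 10) * \<Delta> a * sqrt (up T a) / \<sigma>"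
          using \<Delta> \<open>\<sigma> > 0\<close> by (simp add: sq cu_def)
        also have "\<dots> \<le> (\<mu> best - \<mu> a - 3 * D) * sqrt (up T a) / \<sigma>"
          using 3 \<open>\<sigma> > 0\<close> ev(4)[OF a] by (intro divide_right_mono mult_right_mono) auto
        finally show "cu * ?q T \<le> (\<mu> best - \<mu> a - 3 * D) * sqrt (up T a) / \<sigma>" .
        have "lo T a \<le> \<sigma>\<^sup>2 * (?q T)\<^sup>2 / (\<Delta> a)\<^sup>2"
          unfolding lo_def using assms by (intro divide_right_mono mult_right_mono mult_left_le_one_le) auto
        also have "\<dots> \<le> real T * r T / 2"
          using ev(8)[OF a] T1 \<rho> \<Delta> law.tail_bounds(1)[of "?q T / cl"]
          by (simp add: r_def field_simps)
        finally show "lo T a \<le> real T * r T / 2" .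
        fix x assume x: "1 \<le> x" "x \<le> 1 + lo T a"
        \<comment> \<open>Larger than \<open>lo T a\<close> by a multiple of
          \<open>(q T)\<^sup>2\<close> that is at least 1: room for the initial unit in
          \<open>nbar\<close>.\<close>
        let ?m = "(1 - \<epsilon> / 2) * \<sigma>\<^sup>2 * (?q T)\<^sup>2 / (\<Delta> a)\<^sup>2"
        have "?m = lo T a + \<epsilon> / 2 * \<sigma>\<^sup>2 / (\<Delta> a)\<^sup>2 * (?q T)\<^sup>2"
          using \<Delta> by (simp add: lo_def field_simps)
        then have "x \<le> ?m" using x ev(6)[OF a] by simp
        moreover have "0 \<le> \<mu> best + D - \<mu> a" using \<Delta> D by (simp add: \<Delta>_eq)
        ultimately have "level \<sigma> D N (\<mu> best + D - \<mu> a) x \<le>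
            max ((\<mu> best + D - \<mu> a + D * real N) * sqrt (real N) / \<sigma>) ((\<mu> best + D - \<mu> a + D) * sqrt ?m / \<sigma>)"
          using x N D \<open>\<sigma> > 0\<close> by (intro level_le) auto
        also have "\<dots> \<le> ?q T / cl"
        proof (rule max.boundedI)
          show "(\<mu> best + D - \<mu> a + D * real N) * sqrt (real N) / \<sigma> \<le> ?q T / cl"
            using ev(7)[OF a] cl by (simp add: pos_le_divide_eq)
          have sqm: "sqrt ?m = sqrt (1 - \<epsilon> / 2) * \<sigma> * ?q T / \<Delta> a"
            using \<Delta> q assms by (simp add: real_sqrt_mult real_sqrt_divide)
          have "(\<mu> best + D - \<mu> a + D) * sqrt ?m / \<sigma> \<le> (1 + \<epsilon> / 10) * \<Delta> a * sqrt ?m / \<sigma>"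
          proof (intro divide_right_mono mult_right_mono)
            show "\<mu> best + D - \<mu> a + D \<le> (1 + \<epsilon> / 10) * \<Delta> a"
              using Da D by (simp add: \<Delta>_eq algebra_simps)
          qed (use assms in auto)
          also have "\<dots> = ?q T / cl" using \<Delta> \<open>\<sigma> > 0\<close> by (simp add: sqm cl_def)
          finally show "(\<mu> best + D - \<mu> a + D) * sqrt ?m / \<sigma> \<le> ?q T / cl" .
        qed
        finally show "level \<sigma> D N (\<mu> best + D - \<mu> a) x \<le> ?q T / cl" .
      qed
      \<comment> \<open>Since \<open>q T \<ge> 1\<close>, the Chebyshev error is below the
        expression already arranged to be less than \<open>\<epsilon> / 4\<close>.\<close>
      moreover have "real (card B) * (4 / (real T * r T)) \<le>
          (4 * real (card B) / \<rho>) * ((?q T)\<^sup>2 / (real T * tail \<nu> (?q T / cl)))"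
      proof -
        have "real (card B) * (4 / (real T * r T)) = (4 * real (card B) / \<rho>) * (1 / (real T * tail \<nu> (?q T / cl)))"
          by (simp add: r_def ac_simps)
        also have "\<dots> \<le> (4 * real (card B) / \<rho>) * ((?q T)\<^sup>2 / (real T * tail \<nu> (?q T / cl)))"
          using \<rho> q law.tail_bounds(1)[of "?q T / cl"]
          by (intro mult_left_mono divide_right_mono) auto
        finally show ?thesis .
      qed
      ultimately have "1 - \<epsilon> \<le> prob ?E"
        using pG c(2) ev(2,3) by (simp only: distrib_left)
      also have "prob ?E \<le> prob {\<omega> \<in> space M. \<forall>a\<in>B.
         1 - \<epsilon> \<le> (pulls (\<lambda>s. A s \<omega>) a T / \<sigma>\<^sup>2) / (?q T / \<Delta> a)\<^sup>2 \<and>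
         (pulls (\<lambda>s. A s \<omega>) a T / \<sigma>\<^sup>2) / (?q T / \<Delta> a)\<^sup>2 \<le> 1 + \<epsilon> + c0 / (?q T)\<^sup>2}" (is "_ \<le> prob ?F")
      proof (rule finite_measure_mono)
        have "1 - \<epsilon> \<le> (p / \<sigma>\<^sup>2) / (?q T / \<Delta> a)\<^sup>2 \<and> (p / \<sigma>\<^sup>2) / (?q T / \<Delta> a)\<^sup>2 \<le> 1 + \<epsilon> + c0 / (?q T)\<^sup>2"
          if a: "a \<in> B" and p: "lo T a \<le> p" "p \<le> up T a + c" for a p
        proof -
          note \<Delta> = \<Delta>_pos[OF a]
          let ?u = "\<sigma>\<^sup>2 * (?q T)\<^sup>2 / (\<Delta> a)\<^sup>2"
          have u: "?u > 0" using \<Delta> q \<open>\<sigma> > 0\<close> by simp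
          have ratio: "(p / \<sigma>\<^sup>2) / (?q T / \<Delta> a)\<^sup>2 = p / ?u"
            by (simp add: power_divide)
          have "(1 - \<epsilon>) * ?u \<le> p" using p(1) by (simp add: lo_def)
          \<comment> \<open>The additive \<open>c\<close> is at most
            \<open>\<epsilon> / 2 * ?u\<close>.\<close>
          moreover have "p \<le> (1 + \<epsilon>) * ?u"
            using p(2) ev(5)[OF a] by (simp add: up_def algebra_simps add_divide_distrib)
          ultimately have "1 - \<epsilon> \<le> p / ?u" "p / ?u \<le> 1 + \<epsilon>"
            using u by (simp_all only: pos_le_divide_eq pos_divide_le_eq)
          moreover have "0 \<le> c0 / (?q T)\<^sup>2" by (simp add: c0_def)
          ultimately show ?thesis unfolding ratio by linarith
        qed
        then show "?E \<subseteq> ?F" by blast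
        have "pulls (\<lambda>s. A s \<omega>) a T = n a T \<omega> - 1" for a \<omega> by (simp add: nbar_eq_pulls)
        then show "?F \<in> events" using B(2) by simp
      qed
      finally show "1 - \<epsilon> \<le> prob ?F" .
    qed
  qed
qed

end
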